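(* Let $d\in\mathbb{N}$ and let $M$ be an Orlicz function such that the Orlicz space $L_M$ on $(0,1)$ is separable. There is a constant $c_d$ depending only on $d$ such that for every $f\in L_M(\mathbb{T}^d)$ and every $n\in\mathbb{N}$ there exist an integer $m(n)\le c_dn$ and cubes $(\Pi_k)_{k=1}^{m(n)}$ in $\mathbb{T}^d$ such that (i) each point of $\mathbb{T}^d$ belongs to at least one $\Pi_k$, $1\le k\le m(n)$; (ii) each point of $\mathbb{T}^d$ belongs to at most $c_d$ of the $\Pi_k$, $1\le k\le m(n)$; (iii) $J_f^M(\Pi_k)=\frac1n\|f\|_{L_M}$ for every $1\le k\le m(n)$.
   Context: An Orlicz function is an even convex function $M$ on $\mathbb{R}$ with $M(0)=0$; $L_M$ is the associated Orlicz space with norm $\|g\|_{L_M}=\inf\{\lambda>0:\int M(|g|/\lambda)\le1\}$. $\mathbb{T}^d$ is regarded as the product of $d$ circles and is equipped with the normalised Haar measure $m$; a cube in $\mathbb{T}^d$ is a Cartesian product of $d$ arcs of equal length. For a measurable $A\subset\mathbb{T}^d$ with $m(A)>0$, $\mu(f|_A)$ denotes the decreasing rearrangement of $|f|$ restricted to $A$ (a function on $(0,m(A))$, extended by $0$), the dilation is $(\sigma_u g)(t)=g(t/u)$, and $$J_f^M(A)=m(A)\,\big\|\sigma_{1/m(A)}\mu(f|_A)\big\|_{L_M(0,1)}.$$ Also $\|f\|_{L_M}=\|\mu(f)\|_{L_M(0,1)}$. *)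

theory Defs
  imports "HOL-Analysis.Analysis"
begin

definition orlicz_fun :: "(real \<Rightarrow> real) \<Rightarrow> bool" where
  "orlicz_fun M \<longleftrightarrow> (\<forall>x. M (- x) = M x) \<and> convex_on UNIV M \<and> M 0 = 0"

definition orlicz_space :: "'a measure \<Rightarrow> (real \<Rightarrow> real) \<Rightarrow> ('a \<Rightarrow> 'b::real_normed_vector) set" where
  "orlicz_space N M = {g \<in> borel_measurable N.
     \<exists>r>0. (\<integral>\<^sup>+x. ennreal (M (norm (g x) / r)) \<partial>N) \<le> 1}"

definition orlicz_norm :: "'a measure \<Rightarrow> (real \<Rightarrow> real) \<Rightarrow> ('a \<Rightarrow> 'b::real_normed_vector) \<Rightarrow> real" where
  "orlicz_norm N M g = Inf {r. r > 0 \<and> (\<integral>\<^sup>+x. ennreal (M (norm (g x) / r)) \<partial>N) \<le> 1}"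

definition unit_interval :: "real measure" where
  "unit_interval = restrict_space lborel {0<..<1}"

definition orlicz_separable :: "(real \<Rightarrow> real) \<Rightarrow> bool" where
  "orlicz_separable M \<longleftrightarrow>
     (\<exists>D. countable D \<and> D \<subseteq> (orlicz_space unit_interval M :: (real \<Rightarrow> real) set) \<and>
        (\<forall>g \<in> orlicz_space unit_interval M. \<forall>\<epsilon>>0. \<exists>h\<in>D.
           orlicz_norm unit_interval M (\<lambda>t. g t - h t) < \<epsilon>))"

text \<open>The torus T^d, represented by the fundamental domain [0,1)^d, with
  normalised Haar measure (Lebesgue measure restricted to [0,1)^d).\<close>
definition torus_set :: "(real ^ 'd) set" where
  "torus_set = {x. \<forall>i. 0 \<le> x $ i \<and> x $ i < 1}"

definition torus :: "(real ^ 'd) measure" where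
  "torus = restrict_space lborel torus_set"

text \<open>A cube: product of closed arcs [a_i, a_i + l] (mod 1) of common length 0 < l <= 1.\<close>
definition is_cube :: "(real ^ 'd) set \<Rightarrow> bool" where
  "is_cube A \<longleftrightarrow> (\<exists>a l. 0 < l \<and> l \<le> 1 \<and>
      A = {x \<in> torus_set. \<forall>i. frac (x $ i - a $ i) \<le> l})"

definition rearr :: "'a measure \<Rightarrow> ('a \<Rightarrow> 'b::real_normed_vector) \<Rightarrow> 'a set \<Rightarrow> real \<Rightarrow> real" where
  "rearr N f A t = (if 0 < t \<and> t < measure N A
      then Inf {s. 0 \<le> s \<and> emeasure N {x \<in> A \<inter> space N. norm (f x) > s} \<le> ennreal t}
      else 0)"

text \<open>J_f^M(A) = m(A) * || sigma_{1/m(A)} mu(f|_A) ||_{L_M(0,1)}, where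
  (sigma_u g)(t) = g(t/u), so sigma_{1/m(A)} g (t) = g(t * m(A)).\<close>
definition J_orlicz :: "(real \<Rightarrow> real) \<Rightarrow> (real ^ 'd \<Rightarrow> complex) \<Rightarrow> (real ^ 'd) set \<Rightarrow> real" where
  "J_orlicz M f A = measure torus A *
     orlicz_norm unit_interval M (\<lambda>t. rearr torus f A (t * measure torus A))"

end

theory Submission
  imports Defs
begin

text \<open>Since the rearrangement is equimeasurable with \<open>norm (f x)\<close>, \<open>J(A) = t\<close> holds as soon as the mean of
  \<open>M (norm (f x) * m(A) / t)\<close> over \<open>A\<close> equals 1. Put \<open>t\<close> = norm of \<open>f\<close> divided by \<open>n\<close>. Separability makes
  \<open>M (norm (f x) / t)\<close> integrable, and by convexity this function dominates the integrands, so for every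
  centre \<open>x\<close> that mean is continuous in the side of the cube around \<open>x\<close>; it tends to 0 with the side and is at
  least 1 on the whole torus. Hence there is a cube around \<open>x\<close> with \<open>J = t\<close>.

  A Besicovitch selection (repeatedly take an uncovered centre of almost maximal radius) keeps the overlap
  below a constant \<open>C\<close> depending on \<open>d\<close>. If the integral of \<open>M (norm (f x) / r)\<close> is at most 1, then
  \<open>t \<le> r * (m(A) + integral over A of M (norm (f x) / r))\<close> for each selected cube \<open>A\<close>; summing and using the
  overlap, \<open>N\<close> cubes satisfy \<open>N * t \<le> 2 * C * r\<close>, which bounds \<open>N\<close> by a multiple of \<open>n\<close>.\<close>

section \<open>Orlicz functions and rearrangements\<close>

lemma orlicz_fun_even: "orlicz_fun M \<Longrightarrow> M (- x) = M x"
  and orlicz_fun_zero: "orlicz_fun M \<Longrightarrow> M 0 = 0"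
  by (auto simp: orlicz_fun_def)

lemma orlicz_fun_scale:
  assumes M: "orlicz_fun M" and "0 \<le> a" "a \<le> 1"
  shows "M (a * x) \<le> a * M x"
proof -
  have "convex_on UNIV M" using M by (simp add: orlicz_fun_def)
  from convex_onD[OF this, of a 0 x] show ?thesis
    using assms orlicz_fun_zero[OF M] by simp
qed

lemma orlicz_fun_convex:
  assumes M: "orlicz_fun M" and "0 \<le> a" "a \<le> 1"
  shows "M ((1 - a) * x + a * y) \<le> (1 - a) * M x + a * M y"
  using convex_onD[of UNIV M a x y] assms by (simp add: orlicz_fun_def)

text \<open>\<open>0\<close> is the midpoint of \<open>x\<close> and \<open>- x\<close>, where
  \<open>M\<close> takes equal values.\<close>

lemma orlicz_fun_nonneg:
  assumes M: "orlicz_fun M"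
  shows "0 \<le> M x"
  using orlicz_fun_convex[OF M, of "1/2" x "- x"] orlicz_fun_even[OF M, of x] orlicz_fun_zero[OF M]
  by simp

lemma orlicz_fun_mono:
  assumes M: "orlicz_fun M" and "0 \<le> x" "x \<le> y"
  shows "M x \<le> M y"
proof (cases "y = 0")
  case False
  with assms have "y > 0" by simp
  have "M ((x / y) * y) \<le> (x / y) * M y"
    using assms \<open>y > 0\<close> by (intro orlicz_fun_scale[OF M]) auto
  also have "\<dots> \<le> 1 * M y"
    using assms \<open>y > 0\<close> orlicz_fun_nonneg[OF M] by (intro mult_right_mono) auto
  finally show ?thesis using \<open>y > 0\<close> by simp
qed (use assms in auto)

lemma orlicz_fun_continuous: "orlicz_fun M \<Longrightarrow> continuous_on UNIV M"
  by (simp add: orlicz_fun_def convex_on_continuous)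

lemma orlicz_fun_measurable:
  "orlicz_fun M \<Longrightarrow> M \<in> borel_measurable borel"
  by (simp add: orlicz_fun_continuous borel_measurable_continuous_onI)

text \<open>Convexity together with \<open>M 0 = 0\<close> gains the factor \<open>r / s\<close>
  when the scale is enlarged. This gain, stronger than monotonicity, later turns an equality of
  modulars into the exact value of a norm.\<close>

lemma orlicz_fun_divide:
  assumes M: "orlicz_fun M" and "0 < r" "r \<le> s"
  shows "M (x / s) \<le> (r / s) * M (x / r)"
  using orlicz_fun_scale[OF M, of "r / s" "x / r"] assms by simp

lemma orlicz_fun_divide_mono:
  assumes M: "orlicz_fun M" and "0 < r" "r \<le> s" "0 \<le> x"
  shows "M (x / s) \<le> M (x / r)"
  using assms by (intro orlicz_fun_mono[OF M]) (auto intro: divide_left_mono)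

text \<open>The pointwise triangle inequality behind the Luxemburg norm:
  \<open>(x + y) / (r + s)\<close> is a convex combination of \<open>x / r\<close> and
  \<open>y / s\<close>.\<close>

lemma orlicz_fun_average:
  assumes M: "orlicz_fun M" and r: "0 < r" and s: "0 < s" and "0 \<le> z" "z \<le> x + y" "0 \<le> x" "0 \<le> y"
  shows "M (z / (r + s)) \<le> (r / (r + s)) * M (x / r) + (s / (r + s)) * M (y / s)"
proof -
  have "M (z / (r + s)) \<le> M ((x + y) / (r + s))"
    using assms by (intro orlicz_fun_mono[OF M]) (auto intro: divide_right_mono)
  also have "(x + y) / (r + s) = (1 - s / (r + s)) * (x / r) + s / (r + s) * (y / s)"
  proof -
    have "1 - s / (r + s) = r / (r + s)" using r s by (simp add: field_simps)
    then show ?thesis using r s by (simp add: add_divide_distrib)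
  qed
  also have "M \<dots> \<le> (1 - s / (r + s)) * M (x / r) + s / (r + s) * M (y / s)"
    using r s by (intro orlicz_fun_convex[OF M]) auto
  also have "1 - s / (r + s) = r / (r + s)"
    using r s by (simp add: field_simps)
  finally show ?thesis .
qed

section \<open>Decreasing rearrangement and equimeasurability\<close>

text \<open>The sets where \<open>norm (f x)\<close> exceeds an integer decrease to the empty set,
  so finiteness of the measure makes their measures tend to 0. Thus the infimum in
  \<open>rearr\<close> is over a nonempty set and is not a default value.\<close>

lemma
  assumes "finite_measure N" "f \<in> borel_measurable N" "A \<in> sets N"
  shows rearr_set_nonempty: "0 < t \<Longrightarrow> \<exists>s\<ge>0. emeasure N {x \<in> A \<inter> space N. norm (f x) > s} \<le> ennreal t"
    and rearr_nonneg: "0 \<le> rearr N f A t"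
proof -
  interpret finite_measure N by fact
  note [measurable] = assms(2,3)
  show *: "\<exists>s\<ge>0. emeasure N {x \<in> A \<inter> space N. norm (f x) > s} \<le> ennreal t" if "0 < t" for t
  proof -
    let ?E = "\<lambda>n::nat. {x \<in> A \<inter> space N. norm (f x) > real n}"
    have "(\<lambda>n. measure N (?E n)) \<longlonglongrightarrow> measure N (\<Inter>n. ?E n)"
      by (intro finite_Lim_measure_decseq) (auto simp: decseq_def)
    also have "(\<Inter>n. ?E n) = {}"
      by (auto simp: not_less) (meson not_less reals_Archimedean2 less_asym)
    finally have "(\<lambda>n. measure N (?E n)) \<longlonglongrightarrow> 0" by simp
    then have "\<forall>\<^sub>F n in sequentially. measure N (?E n) < t"
      using that by (rule order_tendstoD)
    then obtain n where "measure N (?E n) < t" by (auto simp: eventually_sequentially)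
    then show ?thesis by (intro exI[of _ "real n"]) (auto simp: emeasure_eq_measure intro: ennreal_leI)
  qed
  show "0 \<le> rearr N f A t"
    using *[of t] by (auto simp: rearr_def intro!: cInf_greatest)
qed

text \<open>The rearrangement is a generalised inverse of the distribution function. One direction
  only uses that the infimum is a lower bound; the other rests on right continuity of the
  distribution function.\<close>

lemma rearr_greater_iff:
  assumes "finite_measure N" "f \<in> borel_measurable N" "A \<in> sets N"
    and t: "0 < t" "t < measure N A" and "0 \<le> s"
  shows "s < rearr N f A t \<longleftrightarrow> t < measure N {x \<in> A \<inter> space N. norm (f x) > s}"
proof -
  interpret finite_measure N by fact
  note [measurable] = assms(2,3)
  let ?E = "\<lambda>s. {x \<in> A \<inter> space N. norm (f x) > s}"
  let ?S = "{s. 0 \<le> s \<and> emeasure N (?E s) \<le> ennreal t}"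
  have r: "rearr N f A t = Inf ?S" using t by (simp add: rearr_def)
  have le_iff: "emeasure N (?E s) \<le> ennreal t \<longleftrightarrow> measure N (?E s) \<le> t" for s
    using t by (simp add: emeasure_eq_measure)
  have bdd: "bdd_below ?S" by (auto simp: bdd_below_def)
  have ne: "?S \<noteq> {}" using rearr_set_nonempty[OF assms(1-3) t(1)] by auto
  show ?thesis
  proof
    assume less: "s < rearr N f A t"
    show "t < measure N (?E s)"
    proof (rule ccontr)
      assume "\<not> t < measure N (?E s)"
      then have "s \<in> ?S" using \<open>0 \<le> s\<close> by (simp only: le_iff mem_Collect_eq not_less)
      from cInf_lower[OF this bdd] less show False by (simp add: r)
    qed
  next
    assume t': "t < measure N (?E s)"
    \<comment> \<open>The level sets slightly above \<open>s\<close> increase to the one at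
      \<open>s\<close>, so some level strictly above \<open>s\<close> still has measure beyond
      \<open>t\<close>; that level is a lower bound of \<open>?S\<close>.\<close>
    let ?F = "\<lambda>n::nat. ?E (s + inverse (real (Suc n)))"
    have "(\<lambda>n. measure N (?F n)) \<longlonglongrightarrow> measure N (\<Union>n. ?F n)"
    proof (intro finite_Lim_measure_incseq)
      show "incseq ?F"
      proof (intro incseq_SucI subsetI)
        fix n x assume x: "x \<in> ?F n"
        have "inverse (real (Suc (Suc n))) \<le> inverse (real (Suc n))"
          by (simp add: field_simps)
        moreover have "s + inverse (real (Suc n)) < norm (f x)" using x by blast
        ultimately have "s + inverse (real (Suc (Suc n))) < norm (f x)" by linarith
        then show "x \<in> ?F (Suc n)" using x by blast
      qed
    qed auto
    also have "(\<Union>n. ?F n) = ?E s"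
    proof safe
      fix x assume "x \<in> A" "x \<in> space N" "s < norm (f x)"
      then obtain n where "inverse (real (Suc n)) < norm (f x) - s"
        using reals_Archimedean[of "norm (f x) - s"] by auto
      then show "x \<in> (\<Union>n. ?F n)" using \<open>x \<in> A\<close> \<open>x \<in> space N\<close> by (auto intro!: exI[of _ n])
    next
      fix x n assume "s + inverse (real (Suc n)) < norm (f x)"
      moreover have "inverse (real (Suc n)) > 0" by simp
      ultimately show "s < norm (f x)" by linarith
    qed
    finally have "\<forall>\<^sub>F n in sequentially. t < measure N (?F n)"
      using t' by (rule order_tendstoD)
    then obtain n where n: "t < measure N (?F n)" by (auto simp: eventually_sequentially)
    have "s + inverse (real (Suc n)) \<le> Inf ?S"
    proof (rule cInf_greatest[OF ne])
      fix u assume "u \<in> ?S"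
      then have u: "measure N (?E u) \<le> t" by (simp only: le_iff mem_Collect_eq)
      show "s + inverse (real (Suc n)) \<le> u"
      proof (rule ccontr)
        assume "\<not> ?thesis"
        then have "measure N (?F n) \<le> measure N (?E u)"
          by (intro finite_measure_mono) auto
        with u n show False by simp
      qed
    qed
    moreover have "inverse (real (Suc n)) > 0" by simp
    ultimately show "s < rearr N f A t" unfolding r by linarith
  qed
qed

lemma space_unit_interval [simp]: "space unit_interval = {0<..<1}"
  and sets_unit_interval: "sets unit_interval = sets (restrict_space borel {0<..<1})"
  by (auto simp: unit_interval_def space_restrict_space sets_restrict_space)

lemma emeasure_unit_interval:
  "0 \<le> b \<Longrightarrow> b \<le> 1 \<Longrightarrow> emeasure unit_interval {0<..<b} = ennreal b"
  unfolding unit_interval_def by (subst emeasure_restrict_space) auto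

text \<open>Pointwise inversion becomes an identity of sets, from which both the measurability and
  the distribution of the dilated rearrangement can be read off.\<close>

lemma rearr_level_set:
  assumes "finite_measure N" "f \<in> borel_measurable N" "A \<in> sets N" "0 < measure N A"
  shows "{t \<in> {0<..<1}. s < rearr N f A (t * measure N A)} =
    {0<..<measure N {x \<in> A \<inter> space N. norm (f x) > s} / measure N A}"
proof -
  interpret finite_measure N by fact
  let ?D = "measure N {x \<in> A \<inter> space N. norm (f x) > s}"
  have D: "?D \<le> measure N A" using assms by (intro finite_measure_mono) auto
  show ?thesis
  \<comment> \<open>The inversion formula needs a nonnegative level; for negative \<open>s\<close>
    both sets are the whole unit interval.\<close>
  proof (cases "s < 0")
    case True
    then have "s < rearr N f A (t * measure N A)" for t
      using rearr_nonneg[OF assms(1-3)] by (meson less_le_trans)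
    moreover have "{x \<in> A \<inter> space N. norm (f x) > s} = A"
      using True sets.sets_into_space[OF assms(3)] by (auto intro: less_le_trans)
    ultimately show ?thesis using assms(4) by auto
  next
    case False
    have "s < rearr N f A (t * measure N A) \<longleftrightarrow> t < ?D / measure N A" if "0 < t" "t < 1" for t
      using False assms(4) that
      by (subst rearr_greater_iff[OF assms(1-3)]) (auto simp: field_simps)
    moreover have "?D / measure N A \<le> 1" using D assms(4) by simp
    ultimately show ?thesis by (auto dest: less_le_trans)
  qed
qed

lemma measurable_rearr:
  assumes "finite_measure N" "f \<in> borel_measurable N" "A \<in> sets N" "0 < measure N A"
  shows "(\<lambda>t. rearr N f A (t * measure N A)) \<in> borel_measurable unit_interval"
proof (rule borel_measurableI_greater)
  fix s
  show "{t \<in> space unit_interval. s < rearr N f A (t * measure N A)} \<in> sets unit_interval"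
    unfolding space_unit_interval rearr_level_set[OF assms]
  proof -
    interpret finite_measure N by fact
    have "measure N {x \<in> A \<inter> space N. norm (f x) > s} \<le> measure N A"
      using assms by (intro finite_measure_mono) auto
    then have "measure N {x \<in> A \<inter> space N. norm (f x) > s} / measure N A \<le> 1"
      using assms(4) by simp
    then show "{0<..<measure N {x \<in> A \<inter> space N. norm (f x) > s} / measure N A} \<in> sets unit_interval"
      by (subst sets_unit_interval, subst sets_restrict_space_iff) auto
  qed
qed

text \<open>Equimeasurability: the dilated rearrangement on the unit interval and
  \<open>norm (f x)\<close> under the normalised measure on \<open>A\<close> have the same law, so
  modulars can be computed on \<open>A\<close> directly.\<close>

lemma nn_integral_rearr:
  assumes fin: "finite_measure N" and f: "f \<in> borel_measurable N" and A: "A \<in> sets N"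
    and pos: "0 < measure N A" and [measurable]: "\<phi> \<in> borel_measurable borel"
  shows "(\<integral>\<^sup>+t. \<phi> (rearr N f A (t * measure N A)) \<partial>unit_interval) =
    (\<integral>\<^sup>+x\<in>A. \<phi> (norm (f x)) \<partial>N) / emeasure N A"
proof -
  interpret finite_measure N by fact
  let ?h = "\<lambda>t. rearr N f A (t * measure N A)"
  let ?m = "measure N A"
  note [measurable] = measurable_rearr[OF fin f A pos] f A
  have "distr unit_interval borel ?h = distr (uniform_measure N A) borel (\<lambda>x. norm (f x))"
  proof (rule measure_eqI_lessThan)
    fix s :: real
    let ?E = "{x \<in> A \<inter> space N. norm (f x) > s}"
    have D: "measure N ?E \<le> ?m" by (intro finite_measure_mono) auto
    have "emeasure (distr unit_interval borel ?h) {s<..} =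
        emeasure unit_interval (?h -` {s<..} \<inter> space unit_interval)"
      by (rule emeasure_distr) auto
    also have "?h -` {s<..} \<inter> space unit_interval = {t \<in> {0<..<1}. s < ?h t}" by auto
    also have "\<dots> = {0<..<measure N ?E / ?m}" by (rule rearr_level_set[OF fin f A pos])
    also have "emeasure unit_interval \<dots> = ennreal (measure N ?E / ?m)"
      using D pos by (intro emeasure_unit_interval) auto
    finally have 1: "emeasure (distr unit_interval borel ?h) {s<..} = ennreal (measure N ?E / ?m)" .
    then show "emeasure (distr unit_interval borel ?h) {s<..} < \<infinity>" by simp
    have "emeasure (distr (uniform_measure N A) borel (\<lambda>x. norm (f x))) {s<..} =
        emeasure (uniform_measure N A) ((\<lambda>x. norm (f x)) -` {s<..} \<inter> space N)"
      by (subst emeasure_distr) auto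
    also have "\<dots> = emeasure N (A \<inter> ((\<lambda>x. norm (f x)) -` {s<..} \<inter> space N)) / emeasure N A"
      by (rule emeasure_uniform_measure) auto
    also have "A \<inter> ((\<lambda>x. norm (f x)) -` {s<..} \<inter> space N) = ?E"
      using sets.sets_into_space[OF A] by auto
    also have "emeasure N ?E / emeasure N A = ennreal (measure N ?E / ?m)"
      using pos by (simp add: emeasure_eq_measure divide_ennreal)
    finally show "emeasure (distr unit_interval borel ?h) {s<..} =
        emeasure (distr (uniform_measure N A) borel (\<lambda>x. norm (f x))) {s<..}"
      using 1 by simp
  qed auto
  note eq = this
  have "(\<integral>\<^sup>+t. \<phi> (?h t) \<partial>unit_interval) = (\<integral>\<^sup>+y. \<phi> y \<partial>distr unit_interval borel ?h)"
    by (simp add: nn_integral_distr)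
  also have "\<dots> = (\<integral>\<^sup>+x. \<phi> (norm (f x)) \<partial>uniform_measure N A)"
    unfolding eq by (subst nn_integral_distr) auto
  also have "\<dots> = (\<integral>\<^sup>+x\<in>A. \<phi> (norm (f x)) \<partial>N) / emeasure N A"
    by (rule nn_integral_uniform_measure) auto
  finally show ?thesis .
qed

section \<open>Separable Orlicz spaces\<close>

lemma orlicz_norm_lessE:
  assumes g: "g \<in> orlicz_space N M" and less: "orlicz_norm N M g < e"
  obtains r where "0 < r" "r < e" "(\<integral>\<^sup>+x. ennreal (M (norm (g x) / r)) \<partial>N) \<le> 1"
proof -
  have "{r. r > 0 \<and> (\<integral>\<^sup>+x. ennreal (M (norm (g x) / r)) \<partial>N) \<le> 1} \<noteq> {}"
    using g by (auto simp: orlicz_space_def)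
  from cInf_lessD[OF this less[unfolded orlicz_norm_def]] show ?thesis
    using that by auto
qed

text \<open>The triangle inequality at the level of modulars, with explicit scales, so that
  attainment of the infimum in the norm is never an issue.\<close>

lemma nn_integral_orlicz_diff:
  fixes g h :: "'a \<Rightarrow> 'b::{real_normed_vector, second_countable_topology}"
  assumes M: "orlicz_fun M" and [measurable]: "g \<in> borel_measurable N" "h \<in> borel_measurable N"
    and r: "0 < r" and s: "0 < s"
    and gr: "(\<integral>\<^sup>+x. ennreal (M (norm (g x) / r)) \<partial>N) \<le> 1"
    and hs: "(\<integral>\<^sup>+x. ennreal (M (norm (h x) / s)) \<partial>N) \<le> 1"
  shows "(\<integral>\<^sup>+x. ennreal (M (norm (g x - h x) / (r + s))) \<partial>N) \<le> 1"
proof -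
  note [measurable] = orlicz_fun_measurable[OF M]
  have "(\<integral>\<^sup>+x. ennreal (M (norm (g x - h x) / (r + s))) \<partial>N)
      \<le> (\<integral>\<^sup>+x. ennreal (r / (r + s)) * ennreal (M (norm (g x) / r)) +
             ennreal (s / (r + s)) * ennreal (M (norm (h x) / s)) \<partial>N)"
  proof (rule nn_integral_mono)
    fix x
    have "M (norm (g x - h x) / (r + s)) \<le> r / (r + s) * M (norm (g x) / r) + s / (r + s) * M (norm (h x) / s)"
      using r s by (intro orlicz_fun_average[OF M] norm_triangle_ineq4) auto
    then show "ennreal (M (norm (g x - h x) / (r + s))) \<le> ennreal (r / (r + s)) * ennreal (M (norm (g x) / r)) +
             ennreal (s / (r + s)) * ennreal (M (norm (h x) / s))"
      using r s orlicz_fun_nonneg[OF M] by (simp flip: ennreal_mult ennreal_plus add: ennreal_leI)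
  qed
  also have "\<dots> = ennreal (r / (r + s)) * (\<integral>\<^sup>+x. ennreal (M (norm (g x) / r)) \<partial>N) +
      ennreal (s / (r + s)) * (\<integral>\<^sup>+x. ennreal (M (norm (h x) / s)) \<partial>N)"
    by (subst nn_integral_add) (auto simp: nn_integral_cmult)
  also have "\<dots> \<le> ennreal (r / (r + s)) * 1 + ennreal (s / (r + s)) * 1"
    using gr hs by (intro add_mono mult_left_mono) auto
  also have "\<dots> = ennreal (r / (r + s) + s / (r + s))" using r s by (simp flip: ennreal_plus)
  also have "r / (r + s) + s / (r + s) = 1" using r s by (simp flip: add_divide_distrib)
  finally show ?thesis by simp
qed

lemma diff_in_orlicz_space:
  fixes g h :: "'a \<Rightarrow> 'b::{real_normed_vector, second_countable_topology}"
  assumes M: "orlicz_fun M" and g: "g \<in> orlicz_space N M" and h: "h \<in> orlicz_space N M"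
  shows "(\<lambda>x. g x - h x) \<in> orlicz_space N M"
proof -
  obtain r s where "0 < r" "0 < s" "(\<integral>\<^sup>+x. ennreal (M (norm (g x) / r)) \<partial>N) \<le> 1"
      "(\<integral>\<^sup>+x. ennreal (M (norm (h x) / s)) \<partial>N) \<le> 1"
    using g h by (auto simp: orlicz_space_def)
  moreover have "g \<in> borel_measurable N" "h \<in> borel_measurable N"
    using g h by (auto simp: orlicz_space_def)
  ultimately show ?thesis
    using nn_integral_orlicz_diff[OF M, of g N h r s]
    by (auto simp: orlicz_space_def intro!: exI[of _ "r + s"])
qed

text \<open>By monotone convergence the finite integrals over \<open>E n\<close> have infinite
  supremum, so each \<open>E k\<close> has a later set whose increment carries integral above 1.
  Iterating this choice gives the blocks.\<close>

lemma disjoint_blocks_of_infinite_integral: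
  fixes F :: "'a \<Rightarrow> ennreal"
  assumes F[measurable]: "F \<in> borel_measurable N" and E: "range E \<subseteq> sets N" "incseq E"
    and cover: "(\<Union>n. E n) = space N"
    and fin: "\<And>n. (\<integral>\<^sup>+x\<in>E n. F x \<partial>N) < \<infinity>" and inf: "(\<integral>\<^sup>+x. F x \<partial>N) = \<infinity>"
  obtains B :: "nat \<Rightarrow> 'a set" where "range B \<subseteq> sets N" "disjoint_family B"
    "\<And>j. 1 < (\<integral>\<^sup>+x\<in>B j. F x \<partial>N)"
proof -
  have meas[measurable]: "E n \<in> sets N" for n using E(1) by auto
  have step: "\<exists>k'>k. 1 < (\<integral>\<^sup>+x\<in>E k' - E k. F x \<partial>N)" for k
  proof -
    have lim: "(SUP n. \<integral>\<^sup>+x\<in>E n. F x \<partial>N) = \<infinity>"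
    proof -
      have "(SUP n. \<integral>\<^sup>+x\<in>E n. F x \<partial>N) = (\<integral>\<^sup>+x. (SUP n. F x * indicator (E n) x) \<partial>N)"
        using E(2)
        by (intro nn_integral_monotone_convergence_SUP[symmetric])
           (auto simp: incseq_def le_fun_def indicator_def)
      also have "\<dots> = (\<integral>\<^sup>+x. F x \<partial>N)"
      proof (rule nn_integral_cong)
        fix x assume "x \<in> space N"
        then obtain n where n: "x \<in> E n" using cover by auto
        show "(SUP n. F x * indicator (E n) x) = F x"
        proof (rule antisym)
          show "(SUP n. F x * indicator (E n) x) \<le> F x"
            by (rule SUP_least) (auto simp: indicator_def)
          show "F x \<le> (SUP n. F x * indicator (E n) x)"
            using n by (intro SUP_upper2[of n]) auto
        qed
      qed
      finally show ?thesis using inf by simp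
    qed
    have "(\<integral>\<^sup>+x\<in>E k. F x \<partial>N) + 1 < (SUP n. \<integral>\<^sup>+x\<in>E n. F x \<partial>N)"
      unfolding lim using fin[of k] by (simp add: less_top[symmetric])
    then obtain n where n: "(\<integral>\<^sup>+x\<in>E k. F x \<partial>N) + 1 < (\<integral>\<^sup>+x\<in>E n. F x \<partial>N)"
      unfolding less_SUP_iff by auto
    \<comment> \<open>The maximum with \<open>Suc k\<close> makes the chosen indices strictly
      increasing.\<close>
    let ?k' = "max n (Suc k)"
    have "(\<integral>\<^sup>+x\<in>E k. F x \<partial>N) + 1 < (\<integral>\<^sup>+x\<in>E ?k'. F x \<partial>N)"
      using incseqD[OF E(2), of n ?k']
      by (intro less_le_trans[OF n] nn_integral_mono) (auto simp: indicator_def)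
    also have "\<dots> = (\<integral>\<^sup>+x. F x * indicator (E k) x + F x * indicator (E ?k' - E k) x \<partial>N)"
      using incseqD[OF E(2), of k ?k']
      by (intro nn_integral_cong) (auto simp: indicator_def le_max_iff_disj)
    also have "\<dots> = (\<integral>\<^sup>+x\<in>E k. F x \<partial>N) + (\<integral>\<^sup>+x\<in>E ?k' - E k. F x \<partial>N)"
      by (rule nn_integral_add) auto
    finally have "1 < (\<integral>\<^sup>+x\<in>E ?k' - E k. F x \<partial>N)"
      using fin[of k] by (simp add: ennreal_add_left_cancel_less)
    then show ?thesis by (intro exI[of _ ?k']) auto
  qed
  then have "\<exists>\<sigma>::nat \<Rightarrow> nat. \<forall>j. True \<and> (\<sigma> j < \<sigma> (Suc j) \<and> 1 < (\<integral>\<^sup>+x\<in>E (\<sigma> (Suc j)) - E (\<sigma> j). F x \<partial>N))"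
    by (intro dependent_nat_choice) auto
  then obtain \<sigma> :: "nat \<Rightarrow> nat" where \<sigma>: "\<And>j. \<sigma> j < \<sigma> (Suc j)"
    "\<And>j. 1 < (\<integral>\<^sup>+x\<in>E (\<sigma> (Suc j)) - E (\<sigma> j). F x \<partial>N)" by blast
  have mono: "strict_mono \<sigma>" using \<sigma>(1) by (simp add: strict_mono_Suc_iff)
  have sub: "E (\<sigma> (Suc i)) \<subseteq> E (\<sigma> j)" if "i < j" for i j
    using that mono by (intro incseqD[OF E(2)]) (simp add: strict_mono_less_eq Suc_leI)
  show ?thesis
  proof (rule that[of "\<lambda>j. E (\<sigma> (Suc j)) - E (\<sigma> j)"])
    show "disjoint_family (\<lambda>j. E (\<sigma> (Suc j)) - E (\<sigma> j))"
      unfolding disjoint_family_on_def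
    proof (intro ballI impI)
      fix i j :: nat assume "i \<noteq> j"
      then have "i < j \<or> j < i" by auto
      then show "(E (\<sigma> (Suc i)) - E (\<sigma> i)) \<inter> (E (\<sigma> (Suc j)) - E (\<sigma> j)) = {}"
        using sub by blast
    qed
  qed (use \<sigma>(2) in auto)
qed

text \<open>If the integral were infinite, cutting \<open>g\<close> into disjoint blocks, each of modular
  larger than 1, would give a separated family indexed by the subsets of the naturals.\<close>

lemma orlicz_separable_integrable:
  assumes M: "orlicz_fun M" and sep: "orlicz_separable M"
    and g: "(g :: real \<Rightarrow> real) \<in> orlicz_space unit_interval M" and r: "0 < r"
  shows "(\<integral>\<^sup>+x. ennreal (M (norm (g x) / r)) \<partial>unit_interval) < \<infinity>"
proof (rule ccontr)
  let ?N = unit_interval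
  let ?F = "\<lambda>x. ennreal (M (norm (g x) / r))"
  assume "\<not> ?thesis"
  then have inf: "(\<integral>\<^sup>+x. ?F x \<partial>?N) = \<infinity>" by (simp add: less_top[symmetric])
  note [measurable] = orlicz_fun_measurable[OF M]
  have [measurable]: "g \<in> borel_measurable ?N" using g by (simp add: orlicz_space_def)
  obtain r0 where r0: "0 < r0" "(\<integral>\<^sup>+x. ennreal (M (norm (g x) / r0)) \<partial>?N) \<le> 1"
    using g by (auto simp: orlicz_space_def)
  \<comment> \<open>Truncation by the size of \<open>g\<close>: the integrand is bounded on each
    \<open>E n\<close> and the interval has finite measure, so every piece has finite
    integral.\<close>
  define E where "E n = {x \<in> space ?N. norm (g x) \<le> real n}" for n
  obtain B :: "nat \<Rightarrow> real set" where B: "range B \<subseteq> sets ?N" "disjoint_family B" "\<And>j. 1 < (\<integral>\<^sup>+x\<in>B j. ?F x \<partial>?N)"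
  proof (rule disjoint_blocks_of_infinite_integral[of ?F ?N E, OF _ _ _ _ _ inf])
    show "?F \<in> borel_measurable ?N" by measurable
    show "range E \<subseteq> sets ?N" by (auto simp del: space_unit_interval simp: E_def)
    show "incseq E" by (auto simp: E_def incseq_def)
    show "(\<Union>n. E n) = space ?N" by (auto simp: E_def intro: real_arch_simple)
    show "(\<integral>\<^sup>+x\<in>E n. ?F x \<partial>?N) < \<infinity>" for n
    proof -
      have "(\<integral>\<^sup>+x\<in>E n. ?F x \<partial>?N) \<le> (\<integral>\<^sup>+x. ennreal (M (real n / r)) \<partial>?N)"
        using r by (intro nn_integral_mono)
          (auto simp: E_def indicator_def intro!: ennreal_leI orlicz_fun_mono[OF M] divide_right_mono)
      also have "\<dots> < \<infinity>"
        using emeasure_unit_interval[of 1] by (simp add: ennreal_mult_less_top)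
      finally show ?thesis .
    qed
  next
    fix C :: "nat \<Rightarrow> real set" assume C: "range C \<subseteq> sets ?N" "disjoint_family C" "\<And>j. 1 < (\<integral>\<^sup>+x\<in>C j. ?F x \<partial>?N)"
    show thesis by (rule that[OF C(1,2)]) (rule C(3))
  qed
  have [measurable]: "B j \<in> sets ?N" for j using B(1) by auto
  \<comment> \<open>One function for each set of blocks; these form the separated family. All lie in
    the space because \<open>norm (g x)\<close> dominates them.\<close>
  define G where "G S x = g x * indicator (\<Union>j\<in>S. B j) x" for S :: "nat set" and x
  have Gm[measurable]: "G S \<in> borel_measurable ?N" for S unfolding G_def by measurable
  have Gle: "norm (G S x) \<le> norm (g x)" for S x by (simp add: G_def indicator_def)
  have G: "G S \<in> orlicz_space ?N M" for S
  proof -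
    have "(\<integral>\<^sup>+x. ennreal (M (norm (G S x) / r0)) \<partial>?N) \<le> (\<integral>\<^sup>+x. ennreal (M (norm (g x) / r0)) \<partial>?N)"
      using r0 Gle by (intro nn_integral_mono ennreal_leI orlicz_fun_mono[OF M] divide_right_mono) auto
    also have "\<dots> \<le> 1" by (rule r0)
    finally show ?thesis using r0 Gm by (auto simp: orlicz_space_def)
  qed
  have far: "1 < (\<integral>\<^sup>+x. ennreal (M (norm (G S x - G T x) / r)) \<partial>?N)" if "S \<noteq> T" for S T
  proof -
    \<comment> \<open>On a block indexed by exactly one of the two sets the difference is
      \<open>g\<close> up to sign, since disjointness excludes all other blocks.\<close>
    obtain j where j: "j \<in> S - T \<or> j \<in> T - S" using \<open>S \<noteq> T\<close> by blast
    have "norm (G S x - G T x) = norm (g x)" if "x \<in> B j" for x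
    proof -
      have "x \<notin> B i" if "i \<noteq> j" for i
        using disjoint_family_onD[OF B(2) _ _ that] \<open>x \<in> B j\<close> by auto
      then have "x \<in> (\<Union>i\<in>U. B i) \<longleftrightarrow> j \<in> U" for U using \<open>x \<in> B j\<close> by (metis UN_iff)
      then show ?thesis using j by (auto simp: G_def indicator_def simp del: UN_iff)
    qed
    then have "(\<integral>\<^sup>+x\<in>B j. ?F x \<partial>?N) \<le> (\<integral>\<^sup>+x. ennreal (M (norm (G S x - G T x) / r)) \<partial>?N)"
      by (intro nn_integral_mono) (auto simp: indicator_def)
    with B(3)[of j] show ?thesis by (rule less_le_trans)
  qed
  obtain D :: "(real \<Rightarrow> real) set" where D: "countable D" "D \<subseteq> orlicz_space ?N M"
    "\<And>g e. g \<in> orlicz_space ?N M \<Longrightarrow> 0 < e \<Longrightarrow> \<exists>h\<in>D. orlicz_norm ?N M (\<lambda>t. g t - h t) < e"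
    using sep unfolding orlicz_separable_def by blast
  \<comment> \<open>The radius is \<open>r / 2\<close> so that two members sharing an approximant
    would differ by a function of modular at most 1 at a scale below \<open>r\<close>.\<close>
  have "\<exists>h\<in>D. orlicz_norm ?N M (\<lambda>t. G S t - h t) < r / 2" for S
    using r by (intro D(3)[OF G]) simp
  then obtain H where H: "\<And>S. H S \<in> D" "\<And>S. orlicz_norm ?N M (\<lambda>t. G S t - H S t) < r / 2"
    by metis
  have "inj H"
  proof (rule injI, rule ccontr)
    fix S T assume eq: "H S = H T" and ne: "S \<noteq> T"
    have HS: "H S \<in> orlicz_space ?N M" for S using H(1) D(2) by auto
    have [measurable]: "H S \<in> borel_measurable ?N" for S using HS[of S] by (simp add: orlicz_space_def)
    obtain a where a: "0 < a" "a < r / 2" "(\<integral>\<^sup>+x. ennreal (M (norm (G S x - H S x) / a)) \<partial>?N) \<le> 1"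
      using orlicz_norm_lessE[OF diff_in_orlicz_space[OF M G HS] H(2)] by blast
    obtain b where b: "0 < b" "b < r / 2" "(\<integral>\<^sup>+x. ennreal (M (norm (G T x - H T x) / b)) \<partial>?N) \<le> 1"
      using orlicz_norm_lessE[OF diff_in_orlicz_space[OF M G HS] H(2)] by blast
    have "(\<integral>\<^sup>+x. ennreal (M (norm (G S x - G T x) / r)) \<partial>?N) \<le>
        (\<integral>\<^sup>+x. ennreal (M (norm ((G S x - H S x) - (G T x - H T x)) / (a + b))) \<partial>?N)"
      using a b unfolding eq
      by (intro nn_integral_mono ennreal_leI) (auto intro!: orlicz_fun_divide_mono[OF M])
    also have "\<dots> \<le> 1" using a b by (intro nn_integral_orlicz_diff[OF M]) auto
    finally show False using far[OF ne] by simp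
  qed
  then have "countable (UNIV :: nat set set)"
    using countable_subset[OF _ D(1), of "range H"] H(1) by (metis countable_image_inj_on image_subsetI)
  then obtain e :: "nat set \<Rightarrow> nat" where "inj e" by (auto simp: countable_def)
  then have "surj (inv e)" by (rule inj_imp_surj_inv)
  with Cantors_theorem[of "UNIV :: nat set"] show False by (metis Pow_UNIV)
qed

section \<open>Cubes and bounded overlap\<close>

text \<open>The representative of \<open>s\<close> modulo 1 of least absolute value.\<close>

definition wrap :: "real \<Rightarrow> real" where
  "wrap s = s - of_int (round s)"

lemma abs_wrap_le: "\<bar>wrap s\<bar> \<le> \<bar>s - of_int k\<bar>"
  unfolding wrap_def by (rule round_diff_minimal)

lemma abs_wrap_le_half: "\<bar>wrap s\<bar> \<le> 1 / 2"
  unfolding wrap_def using of_int_round_abs_le[of s] by linarith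

text \<open>\<open>wrap s - wrap t\<close> represents \<open>s - t\<close> modulo 1, and
  \<open>wrap\<close> picks the representative smallest in absolute value.\<close>

lemma abs_wrap_diff_le: "\<bar>wrap (s - t)\<bar> \<le> \<bar>wrap s - wrap t\<bar>"
  using abs_wrap_le[of "s - t" "round s - round t"] by (simp add: wrap_def algebra_simps)

lemma abs_wrap_minus: "\<bar>wrap (- s)\<bar> = \<bar>wrap s\<bar>"
proof -
  have le: "\<bar>wrap (- s)\<bar> \<le> \<bar>wrap s\<bar>" for s
    using abs_wrap_le[of "- s" "- round s"] by (simp add: wrap_def)
  show ?thesis using le[of s] le[of "- s"] by simp
qed

text \<open>Translates distance from a centre into the arc that starts \<open>h\<close> before it,
  the form used by \<open>is_cube\<close>.\<close>

lemma abs_wrap_le_iff_frac: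
  assumes "0 < h" "h \<le> 1 / 2"
  shows "\<bar>wrap s\<bar> \<le> h \<longleftrightarrow> frac (s + h) \<le> 2 * h"
proof
  assume *: "\<bar>wrap s\<bar> \<le> h"
  show "frac (s + h) \<le> 2 * h"
  \<comment> \<open>For a full circle the bound \<open>2 * h\<close> is 1, above every fractional
    part; for smaller \<open>h\<close> the number \<open>wrap s + h\<close> lies in
    \<open>[0, 1)\<close> and is its own fractional part.\<close>
  proof (cases "h = 1 / 2")
    case True
    then show ?thesis using frac_lt_1[of "s + h"] by simp
  next
    case False
    have "s + h = of_int (round s) + (wrap s + h)" by (simp add: wrap_def)
    then have "frac (s + h) = frac (wrap s + h)" by (metis frac_add_of_int_left)
    also have "\<dots> = wrap s + h" using * assms False by (subst frac_eq) auto
    finally show ?thesis using * by simp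
  qed
next
  assume *: "frac (s + h) \<le> 2 * h"
  have "s - of_int \<lfloor>s + h\<rfloor> = frac (s + h) - h" by (simp add: frac_def)
  then have "\<bar>s - of_int \<lfloor>s + h\<rfloor>\<bar> \<le> h" using * frac_ge_0[of "s + h"] by (simp add: abs_le_iff)
  then show "\<bar>wrap s\<bar> \<le> h" using abs_wrap_le[of s] by (rule order_trans[rotated])
qed

text \<open>The closed ball of radius \<open>h\<close> for the maximum distance on the torus. Cubes
  are described by centre and half side because the Besicovitch argument works with centres.\<close>

definition torus_cube :: "real ^ 'd \<Rightarrow> real \<Rightarrow> (real ^ 'd) set" where
  "torus_cube x h = {y \<in> torus_set. \<forall>i. \<bar>wrap (y $ i - x $ i)\<bar> \<le> h}"

lemma is_cube_torus_cube:
  assumes "0 < h" "h \<le> 1 / 2"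
  shows "is_cube (torus_cube x h)"
proof -
  have "torus_cube x h = {y \<in> torus_set. \<forall>i. frac (y $ i - (\<chi> i. x $ i - h) $ i) \<le> 2 * h}"
    by (simp add: torus_cube_def abs_wrap_le_iff_frac[OF assms] algebra_simps)
  then show ?thesis unfolding is_cube_def using assms by (intro exI[of _ "\<chi> i. x $ i - h"] exI[of _ "2 * h"]) auto
qed

text \<open>The largest radius serves as endpoint of the intermediate value argument and as the
  cover by one cube.\<close>

lemma torus_cube_half: "torus_cube x (1 / 2) = torus_set"
  using abs_wrap_le_half by (auto simp: torus_cube_def)

section \<open>Greedy selection of cubes and its overlap bound\<close>

text \<open>Cutting off after \<open>N\<close> steps keeps the family finite without knowing that
  the process ends; a later count rules out reaching the cut-off. The factor 2 appears because the
  supremum of the radii need not be attained.\<close>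

lemma greedy_selection:
  fixes \<rho> :: "'a \<Rightarrow> real" and U :: "'a \<Rightarrow> 'a set"
  assumes pos: "\<And>x. x \<in> X \<Longrightarrow> 0 < \<rho> x" and bdd: "bdd_above (\<rho> ` X)"
  shows "\<exists>m::nat. \<exists>z. m \<le> N \<and> (\<forall>k<m. z k \<in> X) \<and> (\<forall>k<m. \<forall>j<k. z k \<notin> U (z j) \<and> \<rho> (z k) \<le> 2 * \<rho> (z j))
    \<and> (m = N \<or> X \<subseteq> (\<Union>k<m. U (z k)))"
proof -
  \<comment> \<open>The radius bound is imposed on all points still uncovered when
    \<open>z j\<close> was chosen, not only on the later centres already selected, so that it
    survives adding a new centre.\<close>
  define good where "good m z \<longleftrightarrow> (\<forall>k<m. z k \<in> X) \<and> (\<forall>k<m. \<forall>j<k. z k \<notin> U (z j)) \<and>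
    (\<forall>j<m. \<forall>y \<in> X - (\<Union>i<j. U (z i)). \<rho> y \<le> 2 * \<rho> (z j))" for m :: nat and z
  have "\<exists>m z. m \<le> N \<and> good m z \<and> (m = N \<or> X \<subseteq> (\<Union>k<m. U (z k)))"
  proof (induction N)
    case 0
    show ?case by (intro exI[of _ 0] exI) (simp add: good_def)
  next
    case (Suc N)
    then obtain m z where m: "m \<le> N" "good m z" "m = N \<or> X \<subseteq> (\<Union>k<m. U (z k))" by blast
    show ?case
    proof (cases "X \<subseteq> (\<Union>k<m. U (z k))")
      case True
      then show ?thesis using m(1,2) by (intro exI[of _ m] exI[of _ z] conjI disjI2) simp_all
    next
      case False
      with m have "m = N" by simp
      let ?W = "X - (\<Union>k<m. U (z k))"
      have ne: "?W \<noteq> {}" using False by blast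
      have bW: "bdd_above (\<rho> ` ?W)" by (rule bdd_above_mono[OF bdd]) auto
      obtain y0 where y0: "y0 \<in> ?W" using ne by blast
      have "0 < \<rho> y0" using pos y0 by auto
      also have "\<rho> y0 \<le> Sup (\<rho> ` ?W)" using y0 bW by (intro cSup_upper) auto
      finally have "Sup (\<rho> ` ?W) / 2 < Sup (\<rho> ` ?W)" by simp
      then obtain w where w: "w \<in> ?W" "Sup (\<rho> ` ?W) / 2 < \<rho> w"
        by (rule less_cSupE) (use ne in auto)
      have wmax: "\<rho> y \<le> 2 * \<rho> w" if "y \<in> ?W" for y
        using cSup_upper[OF imageI[OF that] bW] w(2) by linarith
      have gX: "z k \<in> X" if "k < m" for k using m(2) that unfolding good_def by blast
      have gU: "z k \<notin> U (z j)" if "k < m" "j < k" for j k using m(2) that unfolding good_def by blast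
      have g2: "\<rho> y \<le> 2 * \<rho> (z j)" if "j < m" "y \<in> X - (\<Union>i<j. U (z i))" for j y
        using m(2) that unfolding good_def by blast
      define z' where "z' = z(m := w)"
      have z': "z' k = z k" if "k < m" for k using that by (simp add: z'_def)
      have un: "(\<Union>i<j. U (z' i)) = (\<Union>i<j. U (z i))" if "j \<le> m" for j
        using that z' by auto
      have "good (Suc m) z'"
        unfolding good_def
      proof (intro conjI allI impI ballI)
        fix k assume "k < Suc m"
        then consider "k = m" | "k < m" by linarith
        then show "z' k \<in> X" using gX w(1) by cases (auto simp: z'_def)
      next
        fix k j assume "k < Suc m" "j < k"
        then consider "k = m" "j < m" | "k < m" "j < m" by linarith
        then show "z' k \<notin> U (z' j)"
        proof cases
          case 1
          then show ?thesis using w(1) by (auto simp: z'_def)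
        next
          case 2
          then show ?thesis using gU[OF _ \<open>j < k\<close>] by (simp add: z')
        qed
      next
        fix j y assume j: "j < Suc m" and y: "y \<in> X - (\<Union>i<j. U (z' i))"
        have "j \<le> m" using j by simp
        then have y': "y \<in> X - (\<Union>i<j. U (z i))" using y by (simp only: un[OF \<open>j \<le> m\<close>])
        show "\<rho> y \<le> 2 * \<rho> (z' j)"
        proof (cases "j = m")
          case True
          then show ?thesis using y' wmax[of y] by (simp add: z'_def)
        next
          case False
          then have "j < m" using j by simp
          then show ?thesis using g2[OF _ y'] by (simp add: z')
        qed
      qed
      then show ?thesis unfolding \<open>m = N\<close> by (intro exI[of _ "Suc N"] exI[of _ z'] conjI disjI1) simp_all
    qed
  qed
  then obtain m z where m: "m \<le> N" "good m z" "m = N \<or> X \<subseteq> (\<Union>k<m. U (z k))" by blast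
  have "\<rho> (z k) \<le> 2 * \<rho> (z j)" if "k < m" "j < k" for j k
  proof -
    have "\<forall>i<k. z k \<notin> U (z i)" "z k \<in> X" using m(2) that unfolding good_def by blast+
    then have "z k \<in> X - (\<Union>i<j. U (z i))" using that by auto
    moreover have "j < m" using that by simp
    ultimately show ?thesis using m(2) unfolding good_def by blast
  qed
  moreover have "\<forall>k<m. z k \<in> X" "\<forall>k<m. \<forall>j<k. z k \<notin> U (z j)" using m(2) unfolding good_def by blast+
  ultimately show ?thesis using m(1,3) by (intro exI[of _ m] exI[of _ z] conjI) simp_all
qed

text \<open>Index set of the pigeonhole classes: a cube containing \<open>y\<close> is classified by the signs of the
  coordinates of its centre relative to \<open>y\<close>, and by their absolute values rounded down to multiples
  of the radius \<open>\<rho>\<close> of the first selected cube with the same signs. Equal signs force the radii to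
  increase along the selection, hence to lie in \<open>[\<rho>, 2 \<rho>]\<close>; equal cells would put the later centre
  inside the earlier cube.\<close>

definition sign_cells :: "('d \<Rightarrow> bool \<times> int) set" where
  "sign_cells = (\<Pi>\<^sub>E i\<in>UNIV. UNIV \<times> {0, 1, 2})"

lemma finite_sign_cells: "finite (sign_cells :: ('d::finite \<Rightarrow> bool \<times> int) set)"
  unfolding sign_cells_def by (intro finite_PiE) auto

lemma card_torus_cube_overlap:
  fixes z :: "nat \<Rightarrow> real ^ 'd" and r :: "nat \<Rightarrow> real"
  assumes pos: "\<And>k. k < m \<Longrightarrow> 0 < r k" and torus: "\<And>k. k < m \<Longrightarrow> z k \<in> torus_set"
    and sep: "\<And>j k. k < m \<Longrightarrow> j < k \<Longrightarrow> z k \<notin> torus_cube (z j) (r j)"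
    and half: "\<And>j k. k < m \<Longrightarrow> j < k \<Longrightarrow> r k \<le> 2 * r j"
  shows "card {k. k < m \<and> y \<in> torus_cube (z k) (r k)} \<le> card (sign_cells :: ('d \<Rightarrow> bool \<times> int) set)"
proof -
  let ?S = "{k. k < m \<and> y \<in> torus_cube (z k) (r k)}"
  define u where "u k i = wrap (z k $ i - y $ i)" for k i
  have u_le: "\<bar>u k i\<bar> \<le> r k" if "k \<in> ?S" for k i
    using that abs_wrap_minus[of "y $ i - z k $ i"] by (simp add: u_def torus_cube_def)
  \<comment> \<open>Measuring both centres from \<open>y\<close> can only increase their coordinate
    distances, so lying outside the earlier cube survives.\<close>
  have far: "\<exists>i. r j < \<bar>u k i - u j i\<bar>" if jk: "j < k" "k < m" for j k
  proof -
    obtain i where "r j < \<bar>wrap (z k $ i - z j $ i)\<bar>"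
      using sep[OF jk(2,1)] torus[OF jk(2)] by (auto simp: torus_cube_def not_le)
    also have "\<dots> \<le> \<bar>u k i - u j i\<bar>"
      using abs_wrap_diff_le[of "z k $ i - y $ i" "z j $ i - y $ i"] by (simp add: u_def)
    finally show ?thesis by blast
  qed
  define sg where "sg k i \<longleftrightarrow> 0 \<le> u k i" for k i
  define \<rho> where "\<rho> \<sigma> = r (LEAST k. k \<in> ?S \<and> sg k = \<sigma>)" for \<sigma>
  have same: "\<bar>u k i - u j i\<bar> \<le> max \<bar>u k i\<bar> \<bar>u j i\<bar>" if "sg j = sg k" for j k i
    using fun_cong[OF that, of i] by (auto simp: sg_def)
  \<comment> \<open>With equal signs the offsets differ by at most the larger radius; since some
    difference exceeds \<open>r j\<close>, the later radius is the larger one.\<close>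
  have incr: "r j < r k" if "j < k" "j \<in> ?S" "k \<in> ?S" "sg j = sg k" for j k
  proof -
    have "k < m" using that by simp
    from far[OF that(1) this] obtain i where "r j < \<bar>u k i - u j i\<bar>" ..
    also have "\<dots> \<le> max \<bar>u k i\<bar> \<bar>u j i\<bar>" by (rule same[OF that(4)])
    also have "\<dots> \<le> max (r k) (r j)" by (intro max.mono u_le that)
    finally show ?thesis by simp
  qed
  have range: "\<rho> (sg k) \<le> r k \<and> r k \<le> 2 * \<rho> (sg k) \<and> 0 < \<rho> (sg k)" if "k \<in> ?S" for k
  proof -
    define l where "l = (LEAST l. l \<in> ?S \<and> sg l = sg k)"
    have "k \<in> ?S \<and> sg k = sg k" using that by blast
    then have l: "l \<in> ?S \<and> sg l = sg k" and "l \<le> k"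
      unfolding l_def by (rule LeastI, rule Least_le)
    have \<rho>: "\<rho> (sg k) = r l" by (simp only: \<rho>_def l_def)
    have "k < m" "l < m" using that l by simp_all
    show ?thesis
    proof (cases "l = k")
      case True
      then show ?thesis using pos[OF \<open>k < m\<close>] unfolding \<rho> by simp
    next
      case False
      with \<open>l \<le> k\<close> have "l < k" by simp
      have "r l < r k" using incr[OF \<open>l < k\<close>] l that by blast
      then show ?thesis using half[OF \<open>k < m\<close> \<open>l < k\<close>] pos[OF \<open>l < m\<close>] unfolding \<rho> by linarith
    qed
  qed
  define \<Phi> where "\<Phi> k i = (sg k i, \<lfloor>\<bar>u k i\<bar> / \<rho> (sg k)\<rfloor>)" for k i
  have "inj_on \<Phi> ?S"
  proof (rule inj_onI, rule ccontr)
    fix a b assume ab: "a \<in> ?S" "b \<in> ?S" "\<Phi> a = \<Phi> b" "a \<noteq> b"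
    obtain j k where jk: "j \<in> ?S" "k \<in> ?S" "\<Phi> j = \<Phi> k" "j < k"
    proof (cases "a < b")
      case True then show ?thesis using ab that[of a b] by simp
    next
      case False then show ?thesis using ab that[of b a] by simp
    qed
    have sg: "sg j = sg k"
    proof
      fix i show "sg j i = sg k i" using fun_cong[OF jk(3), of i] by (simp add: \<Phi>_def)
    qed
    have "k < m" using jk(2) by simp
    from far[OF jk(4) this] obtain i where i: "r j < \<bar>u k i - u j i\<bar>" ..
    let ?p = "\<rho> (sg k)"
    have p: "0 < ?p" "?p \<le> r j" using range[OF jk(1)] sg by auto
    have "\<lfloor>\<bar>u j i\<bar> / ?p\<rfloor> = \<lfloor>\<bar>u k i\<bar> / ?p\<rfloor>"
      using fun_cong[OF jk(3), of i] sg by (simp add: \<Phi>_def)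
    \<comment> \<open>Equal floors put the absolute values within less than \<open>?p\<close>, which
      is at most \<open>r j\<close>; as the signs agree, this contradicts the choice of
      \<open>i\<close>.\<close>
    then have "\<bar>\<bar>u k i\<bar> / ?p - \<bar>u j i\<bar> / ?p\<bar> < 1" by linarith
    then have "\<bar>\<bar>u k i\<bar> - \<bar>u j i\<bar>\<bar> < ?p"
      using p by (simp flip: diff_divide_distrib add: abs_divide)
    moreover have "\<bar>u k i - u j i\<bar> = \<bar>\<bar>u k i\<bar> - \<bar>u j i\<bar>\<bar>"
      using fun_cong[OF sg, of i] by (auto simp: sg_def)
    ultimately show False using i p by linarith
  qed
  moreover have "\<Phi> ` ?S \<subseteq> sign_cells"
  proof (clarsimp simp: sign_cells_def PiE_UNIV_domain Pi_def)
    fix k i assume "k < m" "y \<in> torus_cube (z k) (r k)"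
    then have k: "k \<in> ?S" by simp
    have "\<bar>u k i\<bar> \<le> 2 * \<rho> (sg k)" using u_le[OF k, of i] range[OF k] by linarith
    then have "\<bar>u k i\<bar> / \<rho> (sg k) \<le> 2" using range[OF k] by (simp add: field_simps)
    moreover have "0 \<le> \<bar>u k i\<bar> / \<rho> (sg k)" using range[OF k] by simp
    ultimately have "\<lfloor>\<bar>u k i\<bar> / \<rho> (sg k)\<rfloor> \<le> 2" "0 \<le> \<lfloor>\<bar>u k i\<bar> / \<rho> (sg k)\<rfloor>" by linarith+
    then have "\<lfloor>\<bar>u k i\<bar> / \<rho> (sg k)\<rfloor> = 0 \<or> \<lfloor>\<bar>u k i\<bar> / \<rho> (sg k)\<rfloor> = 1 \<or> \<lfloor>\<bar>u k i\<bar> / \<rho> (sg k)\<rfloor> = 2"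
      by arith
    then show "\<Phi> k i \<in> UNIV \<times> {0, 1, 2}" by (simp only: \<Phi>_def) blast
  qed
  ultimately show ?thesis by (rule card_inj_on_le[OF _ _ finite_sign_cells])
qed

section \<open>Modulars on torus cubes\<close>

lemma torus_set_borel [measurable]: "torus_set \<in> sets borel"
proof -
  have "torus_set = (\<Inter>i. {x :: real ^ 'd. 0 \<le> x $ i \<and> x $ i < 1})"
    by (auto simp: torus_set_def)
  also have "\<dots> \<in> sets borel" by (intro sets.finite_INT) auto
  finally show ?thesis .
qed

lemma space_torus [simp]: "space torus = torus_set"
  by (simp add: torus_def space_restrict_space)

lemma sets_torus_iff: "A \<in> sets torus \<longleftrightarrow> A \<in> sets borel \<and> A \<subseteq> torus_set"
  unfolding torus_def by (subst sets_restrict_space_iff) auto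

lemma emeasure_torus: "A \<subseteq> torus_set \<Longrightarrow> emeasure torus A = emeasure lborel A"
  unfolding torus_def by (rule emeasure_restrict_space) auto

lemma emeasure_lborel_unit_box: "emeasure lborel (box 0 1 :: (real ^ 'd) set) = 1"
    "emeasure lborel (cbox 0 1 :: (real ^ 'd) set) = 1"
proof -
  have "(1 :: real ^ 'd) \<bullet> b = 1" if "b \<in> Basis" for b
    using that by (auto simp: Basis_vec_def inner_axis)
  then show "emeasure lborel (box 0 1 :: (real ^ 'd) set) = 1"
    "emeasure lborel (cbox 0 1 :: (real ^ 'd) set) = 1"
    by (simp_all add: emeasure_lborel_cbox)
qed

lemma emeasure_torus_set: "emeasure torus (torus_set :: (real ^ 'd) set) = 1"
proof (rule antisym)
  have "emeasure lborel (torus_set :: (real ^ 'd) set) \<le> emeasure lborel (cbox 0 1 :: (real ^ 'd) set)"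
    by (intro emeasure_mono) (auto simp: torus_set_def mem_box_cart less_imp_le)
  then show "emeasure torus (torus_set :: (real ^ 'd) set) \<le> 1"
    by (simp add: emeasure_torus emeasure_lborel_unit_box)
  have "emeasure lborel (box 0 1 :: (real ^ 'd) set) \<le> emeasure lborel (torus_set :: (real ^ 'd) set)"
    by (intro emeasure_mono) (auto simp: torus_set_def mem_box_cart less_imp_le)
  then show "1 \<le> emeasure torus (torus_set :: (real ^ 'd) set)"
    by (simp add: emeasure_torus emeasure_lborel_unit_box)
qed

lemma finite_measure_torus: "finite_measure (torus :: (real ^ 'd) measure)"
  by (rule finite_measureI) (simp add: emeasure_torus_set)

lemma measure_torus_set: "measure torus (torus_set :: (real ^ 'd) set) = 1"
  by (simp add: measure_def emeasure_torus_set)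

lemma measure_torus_le_1: "measure torus (A :: (real ^ 'd) set) \<le> 1"
  using finite_measure.bounded_measure[OF finite_measure_torus, of A] by (simp add: measure_torus_set)

lemma sets_torus_set [measurable]: "torus_set \<in> sets torus"
  by (simp add: sets_torus_iff)

lemma wrap_measurable [measurable]: "wrap \<in> borel_measurable borel"
  unfolding wrap_def round_def by measurable

lemma sets_torus_cube [measurable]: "torus_cube x h \<in> sets torus"
proof -
  have "torus_cube x h = torus_set \<inter> (\<Inter>i. {y. \<bar>wrap (y $ i - x $ i)\<bar> \<le> h})"
    by (auto simp: torus_cube_def)
  also have "\<dots> \<in> sets borel" by (intro sets.Int sets.finite_INT) auto
  finally show ?thesis by (auto simp: sets_torus_iff torus_cube_def)
qed

text \<open>A point of the half-open domain has room in the increasing direction of every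
  coordinate, so the cube contains an open box with corner \<open>x\<close> that does not wrap
  around.\<close>

lemma measure_torus_cube_pos:
  fixes x :: "real ^ 'd"
  assumes x: "x \<in> torus_set" and h: "0 < h"
  shows "0 < measure torus (torus_cube x h)"
proof -
  interpret finite_measure "torus :: (real ^ 'd) measure" by (rule finite_measure_torus)
  define b where "b = (\<chi> i. min 1 (x $ i + h))"
  have less: "x $ i < b $ i" for i using x h by (simp add: b_def torus_set_def)
  have sub: "box x b \<subseteq> torus_cube x h"
  proof
    fix y assume y: "y \<in> box x b"
    have "\<bar>wrap (y $ i - x $ i)\<bar> \<le> h" for i
    proof -
      have "x $ i < y $ i" "y $ i < x $ i + h" using y by (auto simp: mem_box_cart b_def)
      then show ?thesis using abs_wrap_le[of "y $ i - x $ i" 0] by simp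
    qed
    moreover have "0 \<le> y $ i \<and> y $ i < 1" for i
    proof -
      have "x $ i < y $ i" "y $ i < 1" using y by (auto simp: mem_box_cart b_def)
      moreover have "0 \<le> x $ i" using x by (simp add: torus_set_def)
      ultimately show ?thesis by simp
    qed
    ultimately show "y \<in> torus_cube x h" by (simp add: torus_cube_def torus_set_def)
  qed
  have "0 < (\<Prod>c\<in>Basis. (b - x) \<bullet> c)"
    using less by (intro prod_pos) (auto simp: Basis_vec_def inner_axis)
  then have "0 < ennreal (\<Prod>c\<in>Basis. (b - x) \<bullet> c)" by simp
  also have "\<dots> = emeasure lborel (box x b)"
    using less by (subst emeasure_lborel_box) (auto simp: Basis_vec_def inner_axis less_imp_le)
  also have "\<dots> = emeasure torus (box x b)"
    using sub by (intro emeasure_torus[symmetric]) (auto simp: torus_cube_def)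
  also have "\<dots> \<le> emeasure torus (torus_cube x h)"
    using sub by (intro emeasure_mono) auto
  finally show ?thesis by (simp add: emeasure_eq_measure)
qed

lemma AE_lborel_component_neq: "AE y in lborel. (y :: real ^ 'd) $ i \<noteq> c"
proof (rule AE_I')
  have "negligible {y :: real ^ 'd. y $ i = c}" using negligible_standard_hyperplane[of "axis i (1::real)" c] by (simp add: cart_eq_inner_axis axis_in_Basis_iff)
  moreover have "{y :: real ^ 'd. y $ i = c} \<in> sets lborel" by measurable
  ultimately show "{y :: real ^ 'd. y $ i = c} \<in> null_sets lborel"
    by (simp add: negligible_iff_null_sets null_sets_completion_iff)
qed auto

text \<open>The exceptional set lies in countably many hyperplanes, \<open>y $ i\<close> being
  \<open>x $ i + h\<close> or \<open>x $ i - h\<close> up to an integer, and each is null.\<close>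

lemma AE_torus_cube_boundary:
  fixes x :: "real ^ 'd"
  shows "AE y in torus. \<forall>i. \<bar>wrap (y $ i - x $ i)\<bar> \<noteq> h"
proof -
  have "AE y in lborel. \<forall>i\<in>UNIV. \<forall>k::int. y $ i \<noteq> x $ i + of_int k + h \<and> y $ i \<noteq> x $ i + of_int k - h"
    by (intro AE_finite_allI AE_all_countable[THEN iffD2] allI AE_conjI AE_lborel_component_neq) auto
  then have "AE y in lborel. y \<in> torus_set \<longrightarrow> (\<forall>i. \<bar>wrap (y $ i - x $ i)\<bar> \<noteq> h)"
  proof (eventually_elim, intro impI allI notI)
    fix y :: "real ^ 'd" and i
    assume *: "\<forall>i\<in>UNIV. \<forall>k::int. y $ i \<noteq> x $ i + of_int k + h \<and> y $ i \<noteq> x $ i + of_int k - h"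
      and eq: "\<bar>wrap (y $ i - x $ i)\<bar> = h"
    let ?k = "round (y $ i - x $ i)"
    have "y $ i = x $ i + of_int ?k + wrap (y $ i - x $ i)" by (simp add: wrap_def)
    with eq have "y $ i = x $ i + of_int ?k + h \<or> y $ i = x $ i + of_int ?k - h" by linarith
    with * show False by blast
  qed
  then show ?thesis unfolding torus_def by (subst AE_restrict_space_iff) auto
qed

text \<open>Off the exceptional hyperplanes no coordinate distance equals \<open>h\<close>, so every
  comparison with the radius is stable under small changes of it.\<close>

lemma AE_eventually_torus_cube_iff:
  fixes x :: "real ^ 'd"
  assumes X: "X \<longlonglongrightarrow> h"
  shows "AE y in torus. \<forall>\<^sub>F k in sequentially. y \<in> torus_cube x (X k) \<longleftrightarrow> y \<in> torus_cube x h"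
  using AE_torus_cube_boundary[of x h]
proof eventually_elim
  fix y :: "real ^ 'd"
  assume *: "\<forall>i. \<bar>wrap (y $ i - x $ i)\<bar> \<noteq> h"
  have "\<forall>\<^sub>F k in sequentially. \<forall>i. \<bar>wrap (y $ i - x $ i)\<bar> \<le> X k \<longleftrightarrow> \<bar>wrap (y $ i - x $ i)\<bar> \<le> h"
  proof (intro eventually_all_finite)
    fix i
    consider "\<bar>wrap (y $ i - x $ i)\<bar> < h" | "h < \<bar>wrap (y $ i - x $ i)\<bar>"
      using * by (meson linorder_neqE)
    then show "\<forall>\<^sub>F k in sequentially. \<bar>wrap (y $ i - x $ i)\<bar> \<le> X k \<longleftrightarrow> \<bar>wrap (y $ i - x $ i)\<bar> \<le> h"
    proof cases
      case 1
      from order_tendstoD(1)[OF X this] show ?thesis by eventually_elim (use 1 in auto)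
    next
      case 2
      from order_tendstoD(2)[OF X this] show ?thesis by eventually_elim (use 2 in auto)
    qed
  qed
  then show "\<forall>\<^sub>F k in sequentially. y \<in> torus_cube x (X k) \<longleftrightarrow> y \<in> torus_cube x h"
    by eventually_elim (auto simp: torus_cube_def)
qed

lemma AE_notin_torus_cube_0: "AE y in torus. y \<notin> torus_cube x 0"
  using AE_torus_cube_boundary[of x 0] by eventually_elim (auto simp: torus_cube_def)

lemma tendsto_measure_torus_cube:
  fixes x :: "real ^ 'd"
  assumes X: "X \<longlonglongrightarrow> h"
  shows "(\<lambda>k. measure torus (torus_cube x (X k))) \<longlonglongrightarrow> measure torus (torus_cube x h)"
proof -
  interpret finite_measure "torus :: (real ^ 'd) measure" by (rule finite_measure_torus)
  have "(\<lambda>k. \<integral>y. indicator (torus_cube x (X k)) y \<partial>torus) \<longlonglongrightarrow> (\<integral>y. indicator (torus_cube x h) y \<partial>torus :: real)"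
  proof (rule integral_dominated_convergence[where w = "\<lambda>_. 1"])
    show "AE y in torus. (\<lambda>k. indicator (torus_cube x (X k)) y :: real) \<longlonglongrightarrow> indicator (torus_cube x h) y"
      using AE_eventually_torus_cube_iff[OF X, of x]
    proof eventually_elim
      fix y assume "\<forall>\<^sub>F k in sequentially. y \<in> torus_cube x (X k) \<longleftrightarrow> y \<in> torus_cube x h"
      then have "\<forall>\<^sub>F k in sequentially. indicator (torus_cube x (X k)) y = (indicator (torus_cube x h) y :: real)"
        by eventually_elim (simp add: indicator_def)
      then show "(\<lambda>k. indicator (torus_cube x (X k)) y :: real) \<longlonglongrightarrow> indicator (torus_cube x h) y"
        by (rule tendsto_eventually)
    qed
  qed (auto simp: indicator_def)
  moreover have "torus_cube x h \<inter> torus_set = torus_cube x h" for h by (auto simp: torus_cube_def)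
  ultimately show ?thesis by simp
qed

lemma measure_torus_cube_0: "measure torus (torus_cube x 0) = 0"
proof -
  have "{y \<in> space torus. \<not> y \<notin> torus_cube x 0} = torus_cube x 0" by (auto simp: torus_cube_def)
  from AE_iff_measurable[OF sets_torus_cube this] AE_notin_torus_cube_0[of x]
  show ?thesis by (simp add: measure_def)
qed

text \<open>By convexity \<open>M (v * s) / v \<le> M s\<close> for \<open>0 < v \<le> 1\<close>, so \<open>M (norm (f y) / t)\<close>
  dominates the integrand uniformly down to \<open>h = 0\<close>, where the value is the junk quotient by 0.\<close>

lemma continuous_on_torus_cube_modular:
  fixes x :: "real ^ 'd" and f :: "real ^ 'd \<Rightarrow> 'b::{banach, second_countable_topology}"
  assumes M: "orlicz_fun M" and [measurable]: "f \<in> borel_measurable torus" and x: "x \<in> torus_set"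
    and fin: "(\<integral>\<^sup>+y. ennreal (M (norm (f y) / t)) \<partial>torus) < \<infinity>"
  shows "continuous_on {0..1/2} (\<lambda>h. \<integral>y. indicator (torus_cube x h) y *
    (M (measure torus (torus_cube x h) * (norm (f y) / t)) / measure torus (torus_cube x h)) \<partial>torus)"
proof (unfold continuous_on_sequentially, intro ballI allI impI, elim conjE)
  fix h :: real and X :: "nat \<Rightarrow> real"
  assume h: "h \<in> {0..1/2}" and X: "X \<longlonglongrightarrow> h"
  note [measurable] = orlicz_fun_measurable[OF M]
  define V where "V h = measure torus (torus_cube x h)" for h
  define H where "H h y = indicator (torus_cube x h) y * (M (V h * (norm (f y) / t)) / V h)" for h y
  have VX: "(\<lambda>k. V (X k)) \<longlonglongrightarrow> V h" unfolding V_def by (rule tendsto_measure_torus_cube[OF X])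
  have "(\<lambda>k. \<integral>y. H (X k) y \<partial>torus) \<longlonglongrightarrow> (\<integral>y. H h y \<partial>torus)"
  proof (rule integral_dominated_convergence[where w = "\<lambda>y. M (norm (f y) / t)"])
    show "integrable torus (\<lambda>y. M (norm (f y) / t))"
      using fin orlicz_fun_nonneg[OF M] by (intro integrableI_nonneg) auto
    show "AE y in torus. norm (H (X k) y) \<le> M (norm (f y) / t)" for k
    proof (rule AE_I2)
      fix y
      show "norm (H (X k) y) \<le> M (norm (f y) / t)"
      proof (cases "V (X k) = 0")
        case True
        then show ?thesis using orlicz_fun_nonneg[OF M] by (simp add: H_def)
      next
        case False
        then have V: "0 < V (X k)" "V (X k) \<le> 1"
          using measure_torus_le_1 by (auto simp: V_def zero_less_measure_iff)
        have "M (V (X k) * (norm (f y) / t)) \<le> V (X k) * M (norm (f y) / t)"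
          using V by (intro orlicz_fun_scale[OF M]) auto
        then have "M (V (X k) * (norm (f y) / t)) / V (X k) \<le> M (norm (f y) / t)"
          using V by (simp add: pos_divide_le_eq mult.commute)
        then show ?thesis
          using V orlicz_fun_nonneg[OF M] by (auto simp: H_def indicator_def abs_mult)
      qed
    qed
    \<comment> \<open>At \<open>h = 0\<close> the quotient is a default value, but the degenerate
      cube is null. Elsewhere membership in the limit cube forces \<open>V h\<close> to be
      positive.\<close>
    have "AE y in torus. h = 0 \<longrightarrow> y \<notin> torus_cube x h"
      using AE_notin_torus_cube_0[of x] by eventually_elim auto
    then show "AE y in torus. (\<lambda>k. H (X k) y) \<longlonglongrightarrow> H h y"
      using AE_eventually_torus_cube_iff[OF X, of x]
    proof eventually_elim
      fix y
      assume 0: "h = 0 \<longrightarrow> y \<notin> torus_cube x h"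
        and ev: "\<forall>\<^sub>F k in sequentially. y \<in> torus_cube x (X k) \<longleftrightarrow> y \<in> torus_cube x h"
      show "(\<lambda>k. H (X k) y) \<longlonglongrightarrow> H h y"
      proof (cases "y \<in> torus_cube x h")
        case False
        have "\<forall>\<^sub>F k in sequentially. H (X k) y = H h y"
          using ev by eventually_elim (use False in \<open>simp add: H_def\<close>)
        then show ?thesis by (rule tendsto_eventually)
      next
        case True
        with 0 h have "0 < h" by (cases "h = 0") auto
        then have "0 < V h" unfolding V_def by (rule measure_torus_cube_pos[OF x])
        have "isCont M z" for z
          using orlicz_fun_continuous[OF M] by (simp add: continuous_on_eq_continuous_at)
        then have "(\<lambda>k. M (V (X k) * (norm (f y) / t)) / V (X k)) \<longlonglongrightarrow> M (V h * (norm (f y) / t)) / V h"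
          using \<open>0 < V h\<close> by (intro tendsto_divide VX isCont_tendsto_compose[of _ M] tendsto_mult tendsto_const) auto
        moreover have "\<forall>\<^sub>F k in sequentially. M (V (X k) * (norm (f y) / t)) / V (X k) = H (X k) y"
          using ev by eventually_elim (use True in \<open>simp add: H_def\<close>)
        ultimately have "(\<lambda>k. H (X k) y) \<longlonglongrightarrow> M (V h * (norm (f y) / t)) / V h"
          by (rule Lim_transform_eventually)
        then show ?thesis using True by (simp add: H_def)
      qed
    qed
    show "H h \<in> borel_measurable torus" "\<And>k. H (X k) \<in> borel_measurable torus"
      unfolding H_def by measurable
  qed
  then show "((\<lambda>h. \<integral>y. indicator (torus_cube x h) y *
    (M (measure torus (torus_cube x h) * (norm (f y) / t)) / measure torus (torus_cube x h)) \<partial>torus) \<circ> X)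
    \<longlonglongrightarrow> (\<integral>y. indicator (torus_cube x h) y *
    (M (measure torus (torus_cube x h) * (norm (f y) / t)) / measure torus (torus_cube x h)) \<partial>torus)"
    by (simp add: H_def V_def o_def)
qed

lemma exists_torus_cube_modular:
  fixes x :: "real ^ 'd" and f :: "real ^ 'd \<Rightarrow> 'b::{banach, second_countable_topology}"
  assumes M: "orlicz_fun M" and f[measurable]: "f \<in> borel_measurable torus" and x: "x \<in> torus_set"
    and fin: "(\<integral>\<^sup>+y. ennreal (M (norm (f y) / t)) \<partial>torus) < \<infinity>"
    and gt: "1 \<le> (\<integral>\<^sup>+y. ennreal (M (norm (f y) / t)) \<partial>torus)"
  obtains h where "0 < h" "h \<le> 1 / 2"
    "(\<integral>\<^sup>+y\<in>torus_cube x h. ennreal (M (norm (f y) / (t / measure torus (torus_cube x h)))) \<partial>torus)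
      = emeasure torus (torus_cube x h)"
proof -
  interpret finite_measure "torus :: (real ^ 'd) measure" by (rule finite_measure_torus)
  note [measurable] = orlicz_fun_measurable[OF M]
  define V where "V h = measure torus (torus_cube x h)" for h
  \<comment> \<open>A real-valued mean, so that the intermediate value theorem applies on the closed
    interval; at \<open>h = 0\<close> it vanishes because the cube has measure 0.\<close>
  define G where "G h = (\<integral>y. indicator (torus_cube x h) y * (M (V h * (norm (f y) / t)) / V h) \<partial>torus)" for h
  have int: "integrable torus (\<lambda>y. M (norm (f y) / t))"
    using fin orlicz_fun_nonneg[OF M] by (intro integrableI_nonneg) auto
  have cont: "continuous_on {0..1/2} G"
    unfolding G_def V_def by (rule continuous_on_torus_cube_modular[OF M f x fin])
  have G0: "G 0 = 0" by (simp add: G_def V_def measure_torus_cube_0)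
  have "G (1/2) = (\<integral>y. M (norm (f y) / t) \<partial>torus)"
    unfolding G_def V_def torus_cube_half measure_torus_set
    by (intro Bochner_Integration.integral_cong) auto
  also have "1 \<le> ennreal \<dots>"
    using gt int orlicz_fun_nonneg[OF M] by (simp add: nn_integral_eq_integral)
  finally have "1 \<le> G (1/2)" by simp
  then obtain h where h: "0 \<le> h" "h \<le> 1/2" "G h = 1"
    using IVT'[of G 0 1 "1/2"] cont G0 by auto
  with G0 have "0 < h" by (cases "h = 0") auto
  then have V: "0 < V h" unfolding V_def by (rule measure_torus_cube_pos[OF x])
  let ?F = "\<lambda>y. indicator (torus_cube x h) y * M (V h * (norm (f y) / t))"
  \<comment> \<open>Integrability allows the return from the real integral to the nonnegative one;
    it follows by scaling, since \<open>V h\<close> is at most 1.\<close>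
  have intF: "integrable torus ?F"
  proof (rule Bochner_Integration.integrable_bound[OF int])
    show "AE y in torus. norm (?F y) \<le> norm (M (norm (f y) / t))"
    proof (rule AE_I2)
      fix y
      have "M (V h * (norm (f y) / t)) \<le> V h * M (norm (f y) / t)"
        using V measure_torus_le_1[of "torus_cube x h"] by (intro orlicz_fun_scale[OF M]) (auto simp: V_def)
      also have "\<dots> \<le> 1 * M (norm (f y) / t)"
        using measure_torus_le_1[of "torus_cube x h"] orlicz_fun_nonneg[OF M]
        by (intro mult_right_mono) (auto simp: V_def)
      finally show "norm (?F y) \<le> norm (M (norm (f y) / t))"
        using orlicz_fun_nonneg[OF M] by (auto simp: indicator_def)
    qed
  qed measurable
  have "(\<integral>y. ?F y \<partial>torus) = V h * G h"
    using V by (simp add: G_def)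
  then have "(\<integral>\<^sup>+y. ennreal (?F y) \<partial>torus) = ennreal (V h)"
    using h intF orlicz_fun_nonneg[OF M] by (subst nn_integral_eq_integral) auto
  also have "(\<integral>\<^sup>+y. ennreal (?F y) \<partial>torus) =
      (\<integral>\<^sup>+y\<in>torus_cube x h. ennreal (M (norm (f y) / (t / V h))) \<partial>torus)"
    by (intro nn_integral_cong) (auto simp: indicator_def mult.commute)
  finally show ?thesis
    using that[OF \<open>0 < h\<close> h(2)] by (simp add: V_def emeasure_eq_measure)
qed

section \<open>The functional J\<close>

lemma ennreal_divide_le_1_iff:
  fixes x :: ennreal and m :: real
  assumes "0 < m"
  shows "x / ennreal m \<le> 1 \<longleftrightarrow> x \<le> ennreal m"
  using assms by (cases x) (auto simp: divide_ennreal ennreal_top_divide top_unique)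

text \<open>By equimeasurability this is a Luxemburg norm for the normalised measure on
  \<open>A\<close>, with the normalisation moved to the right-hand side of the constraint.\<close>

lemma orlicz_norm_rearr:
  assumes fin: "finite_measure N" and M: "orlicz_fun M" and f: "f \<in> borel_measurable N"
    and A: "A \<in> sets N" and pos: "0 < measure N A"
  shows "orlicz_norm unit_interval M (\<lambda>t. rearr N f A (t * measure N A)) =
    Inf {r. r > 0 \<and> (\<integral>\<^sup>+x\<in>A. ennreal (M (norm (f x) / r)) \<partial>N) \<le> emeasure N A}"
proof -
  interpret finite_measure N by fact
  note [measurable] = orlicz_fun_measurable[OF M]
  have "(\<integral>\<^sup>+t. ennreal (M (norm (rearr N f A (t * measure N A)) / r)) \<partial>unit_interval) \<le> 1 \<longleftrightarrow>
      (\<integral>\<^sup>+x\<in>A. ennreal (M (norm (f x) / r)) \<partial>N) \<le> emeasure N A" for r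
    using nn_integral_rearr[OF fin f A pos, of "\<lambda>y. ennreal (M (norm y / r))"] pos
    by (simp add: emeasure_eq_measure ennreal_divide_le_1_iff)
  then show ?thesis by (simp add: orlicz_norm_def)
qed

lemma J_orlicz_torus_set:
  assumes M: "orlicz_fun M" and f: "f \<in> borel_measurable torus"
  shows "J_orlicz M f torus_set = orlicz_norm torus M f"
proof -
  have "(\<integral>\<^sup>+x\<in>torus_set. ennreal (M (norm (f x) / r)) \<partial>torus) =
      (\<integral>\<^sup>+x. ennreal (M (norm (f x) / r)) \<partial>torus)" for r
    by (intro nn_integral_cong) auto
  then show ?thesis
    using orlicz_norm_rearr[OF finite_measure_torus M f sets_torus_set]
    by (simp add: J_orlicz_def measure_torus_set emeasure_torus_set orlicz_norm_def)
qed

lemma nn_integral_orlicz_divide: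
  assumes M: "orlicz_fun M" and [measurable]: "f \<in> borel_measurable N" "A \<in> sets N"
    and r: "0 < r" and "r \<le> s"
  shows "(\<integral>\<^sup>+x\<in>A. ennreal (M (norm (f x) / s)) \<partial>N) \<le> ennreal (r / s) * (\<integral>\<^sup>+x\<in>A. ennreal (M (norm (f x) / r)) \<partial>N)"
proof -
  note [measurable] = orlicz_fun_measurable[OF M]
  have "(\<integral>\<^sup>+x\<in>A. ennreal (M (norm (f x) / s)) \<partial>N)
      \<le> (\<integral>\<^sup>+x. ennreal (r / s) * (ennreal (M (norm (f x) / r)) * indicator A x) \<partial>N)"
  proof (rule nn_integral_mono)
    fix x
    have "ennreal (M (norm (f x) / s)) \<le> ennreal (r / s) * ennreal (M (norm (f x) / r))"
      using orlicz_fun_divide[OF M r \<open>r \<le> s\<close>, of "norm (f x)"] assms orlicz_fun_nonneg[OF M]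
      by (simp flip: ennreal_mult add: ennreal_leI)
    then show "ennreal (M (norm (f x) / s)) * indicator A x
        \<le> ennreal (r / s) * (ennreal (M (norm (f x) / r)) * indicator A x)"
      by (simp add: indicator_def)
  qed
  also have "\<dots> = ennreal (r / s) * (\<integral>\<^sup>+x\<in>A. ennreal (M (norm (f x) / r)) \<partial>N)"
    by (rule nn_integral_cmult) auto
  finally show ?thesis .
qed

text \<open>Equality of the modular identifies the infimum: by the scaling gain, a smaller
  admissible scale would push the modular at \<open>t / measure torus A\<close> strictly below the
  measure of \<open>A\<close>.\<close>

lemma J_orlicz_eqI:
  fixes f :: "real ^ 'd \<Rightarrow> complex"
  assumes M: "orlicz_fun M" and f[measurable]: "f \<in> borel_measurable torus"
    and A[measurable]: "A \<in> sets torus" and pos: "0 < measure torus A" and t: "0 < t"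
    and eq: "(\<integral>\<^sup>+y\<in>A. ennreal (M (norm (f y) / (t / measure torus A))) \<partial>torus) = emeasure torus A"
  shows "J_orlicz M f A = t"
proof -
  interpret finite_measure "torus :: (real ^ 'd) measure" by (rule finite_measure_torus)
  note [measurable] = orlicz_fun_measurable[OF M]
  let ?v = "measure torus A"
  let ?S = "{r. r > 0 \<and> (\<integral>\<^sup>+x\<in>A. ennreal (M (norm (f x) / r)) \<partial>torus) \<le> emeasure torus A}"
  have "Inf ?S = t / ?v"
  proof (rule cInf_eq_minimum)
    show "t / ?v \<in> ?S" using t pos eq by simp
    fix r assume r: "r \<in> ?S"
    show "t / ?v \<le> r"
    proof (rule ccontr)
      assume "\<not> t / ?v \<le> r"
      then have less: "r < t / ?v" and "0 < r" using r by auto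
      have "emeasure torus A \<le> ennreal (r / (t / ?v)) * (\<integral>\<^sup>+y\<in>A. ennreal (M (norm (f y) / r)) \<partial>torus)"
        unfolding eq[symmetric] using less \<open>0 < r\<close>
        by (intro nn_integral_orlicz_divide[OF M]) auto
      also have "\<dots> \<le> ennreal (r / (t / ?v)) * emeasure torus A"
        using r by (intro mult_left_mono) auto
      also have "\<dots> = ennreal (r / (t / ?v) * ?v)"
        unfolding emeasure_eq_measure
        using \<open>0 < r\<close> t by (intro ennreal_mult[symmetric]) auto
      finally have "?v \<le> r / (t / ?v) * ?v"
        using \<open>0 < r\<close> t by (simp add: emeasure_eq_measure ennreal_le_iff)
      then have "1 * ?v \<le> r / (t / ?v) * ?v" by (simp only: mult_1)
      then have "1 \<le> r / (t / ?v)" using pos by (rule mult_right_le_imp_le)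
      then have "t / ?v \<le> r" using t pos by (simp add: field_simps)
      with less show False by simp
    qed
  qed
  then show ?thesis
    using pos unfolding J_orlicz_def orlicz_norm_rearr[OF finite_measure_torus M f A pos] by simp
qed

section \<open>Estimates for counting the selected cubes\<close>

text \<open>If \<open>t / measure torus A\<close> is at most \<open>r\<close>, the first summand
  suffices; otherwise rescaling from \<open>r\<close> up to that quotient shows that the second
  does. Both summands are integrals over \<open>A\<close>, so the bound can be summed over cubes of
  bounded overlap.\<close>

lemma modular_cube_lower_bound:
  fixes f :: "real ^ 'd \<Rightarrow> complex"
  assumes M: "orlicz_fun M" and f[measurable]: "f \<in> borel_measurable torus"
    and A[measurable]: "A \<in> sets torus" and pos: "0 < measure torus A" and t: "0 < t" and r: "0 < r"
    and eq: "(\<integral>\<^sup>+y\<in>A. ennreal (M (norm (f y) / (t / measure torus A))) \<partial>torus) = emeasure torus A"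
  shows "ennreal t \<le> ennreal r * (emeasure torus A + (\<integral>\<^sup>+y\<in>A. ennreal (M (norm (f y) / r)) \<partial>torus))"
proof -
  interpret finite_measure "torus :: (real ^ 'd) measure" by (rule finite_measure_torus)
  note [measurable] = orlicz_fun_measurable[OF M]
  let ?v = "measure torus A"
  let ?I = "\<integral>\<^sup>+y\<in>A. ennreal (M (norm (f y) / r)) \<partial>torus"
  show ?thesis
  proof (cases "t / ?v \<le> r")
    case True
    then have "t \<le> r * ?v" using pos by (simp add: field_simps)
    then have "ennreal t \<le> ennreal r * emeasure torus A"
      using r by (simp add: emeasure_eq_measure ennreal_leI flip: ennreal_mult)
    also have "\<dots> \<le> ennreal r * (emeasure torus A + ?I)" by (intro mult_left_mono) auto
    finally show ?thesis .
  next
    case False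
    then have less: "r \<le> t / ?v" by simp
    have "emeasure torus A \<le> ennreal (r / (t / ?v)) * ?I"
      unfolding eq[symmetric] by (intro nn_integral_orlicz_divide[OF M _ _ r less]) auto
    then have "ennreal (t / ?v) * emeasure torus A \<le> ennreal (t / ?v) * (ennreal (r / (t / ?v)) * ?I)"
      by (rule mult_left_mono) simp
    also have "ennreal (t / ?v) * emeasure torus A = ennreal t"
      using t pos by (simp add: emeasure_eq_measure flip: ennreal_mult)
    also have "ennreal (t / ?v) * (ennreal (r / (t / ?v)) * ?I) = ennreal r * ?I"
      using t pos r by (simp add: mult.assoc[symmetric] flip: ennreal_mult)
    also have "\<dots> \<le> ennreal r * (emeasure torus A + ?I)" by (intro mult_left_mono) auto
    finally show ?thesis .
  qed
qed

lemma sum_nn_integral_overlap_le: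
  fixes F :: "'a \<Rightarrow> ennreal" and m :: nat
  assumes [measurable]: "F \<in> borel_measurable N" "\<And>k. k < m \<Longrightarrow> A k \<in> sets N"
    and overlap: "\<And>y. y \<in> space N \<Longrightarrow> card {k. k < m \<and> y \<in> A k} \<le> C"
  shows "(\<Sum>k<m. \<integral>\<^sup>+y\<in>A k. F y \<partial>N) \<le> of_nat C * (\<integral>\<^sup>+y. F y \<partial>N)"
proof -
  have "(\<Sum>k<m. \<integral>\<^sup>+y\<in>A k. F y \<partial>N) = (\<integral>\<^sup>+y. (\<Sum>k<m. F y * indicator (A k) y) \<partial>N)"
    by (rule nn_integral_sum[symmetric]) auto
  also have "\<dots> \<le> (\<integral>\<^sup>+y. of_nat C * F y \<partial>N)"
  proof (rule nn_integral_mono)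
    fix y assume y: "y \<in> space N"
    have "(\<Sum>k<m. F y * indicator (A k) y) = F y * (\<Sum>k<m. indicator (A k) y)"
      by (rule sum_distrib_left[symmetric])
    also have "(\<Sum>k<m. indicator (A k) y) = (of_nat (card {k. k < m \<and> y \<in> A k}) :: ennreal)"
      proof -
      have "(\<Sum>k<m. indicator (A k) y :: ennreal) = (\<Sum>k \<in> {k \<in> {..<m}. y \<in> A k}. 1)"
        by (rule sum.mono_neutral_cong_right) (auto simp: indicator_def)
      then show ?thesis by simp
    qed
    also have "F y * \<dots> \<le> F y * of_nat C"
      using overlap[OF y] by (intro mult_left_mono of_nat_mono) auto
    finally show "(\<Sum>k<m. F y * indicator (A k) y) \<le> of_nat C * F y" by (simp add: mult.commute)
  qed
  also have "\<dots> = of_nat C * (\<integral>\<^sup>+y. F y \<partial>N)" by (rule nn_integral_cmult) auto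
  finally show ?thesis .
qed

text \<open>Separability concerns the unit interval, so \<open>f\<close> is replaced by its
  rearrangement there, which has the same modulars.\<close>

lemma nn_integral_orlicz_torus_finite:
  fixes f :: "real ^ 'd \<Rightarrow> complex"
  assumes M: "orlicz_fun M" and sep: "orlicz_separable M" and f: "f \<in> orlicz_space torus M" and r: "0 < r"
  shows "(\<integral>\<^sup>+y. ennreal (M (norm (f y) / r)) \<partial>torus) < \<infinity>"
proof -
  note [measurable] = orlicz_fun_measurable[OF M]
  have fm: "f \<in> borel_measurable torus" using f by (simp add: orlicz_space_def)
  have pos: "0 < measure torus (torus_set :: (real ^ 'd) set)" by (simp add: measure_torus_set)
  let ?g = "\<lambda>t. rearr torus f torus_set t"
  have eq: "(\<integral>\<^sup>+t. ennreal (M (norm (?g t) / r)) \<partial>unit_interval) =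
      (\<integral>\<^sup>+y. ennreal (M (norm (f y) / r)) \<partial>torus)" for r
  proof -
    have "(\<integral>\<^sup>+t. ennreal (M (norm (?g t) / r)) \<partial>unit_interval) =
        (\<integral>\<^sup>+y\<in>torus_set. ennreal (M (norm (f y) / r)) \<partial>torus)"
      using nn_integral_rearr[OF finite_measure_torus fm sets_torus_set pos, of "\<lambda>y. ennreal (M (norm y / r))"]
      by (simp add: measure_torus_set emeasure_torus_set divide_ennreal_def)
    also have "\<dots> = (\<integral>\<^sup>+y. ennreal (M (norm (f y) / r)) \<partial>torus)"
      by (intro nn_integral_cong) auto
    finally show ?thesis .
  qed
  have "?g \<in> orlicz_space unit_interval M"
    using f measurable_rearr[OF finite_measure_torus fm sets_torus_set pos]
    unfolding orlicz_space_def mem_Collect_eq eq by (simp add: measure_torus_set)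
  from orlicz_separable_integrable[OF M sep this r] show ?thesis unfolding eq .
qed

lemma orlicz_norm_nonneg:
  assumes "f \<in> orlicz_space N M"
  shows "0 \<le> orlicz_norm N M f"
  unfolding orlicz_norm_def using assms by (intro cInf_greatest) (auto simp: orlicz_space_def)

lemma modular_gt_1:
  assumes "0 < r" "r < orlicz_norm N M f"
  shows "1 < (\<integral>\<^sup>+y. ennreal (M (norm (f y) / r)) \<partial>N)"
proof (rule ccontr)
  assume "\<not> ?thesis"
  then have "orlicz_norm N M f \<le> r"
    using assms unfolding orlicz_norm_def by (intro cInf_lower) (auto simp: bdd_below_def intro!: exI[of _ 0])
  with assms show False by simp
qed

theorem theorem3p1:
  "\<exists>c::nat. \<forall>(M::real \<Rightarrow> real) (f::real ^ 'd \<Rightarrow> complex) (n::nat).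
     orlicz_fun M \<and> orlicz_separable M \<and> f \<in> orlicz_space torus M \<and> n \<ge> 1 \<longrightarrow>
     (\<exists>(m::nat) (P::nat \<Rightarrow> (real ^ 'd) set).
        m \<le> c * n \<and>
        (\<forall>k\<in>{1..m}. is_cube (P k)) \<and>
        (\<forall>x\<in>torus_set. \<exists>k\<in>{1..m}. x \<in> P k) \<and>
        (\<forall>x\<in>torus_set. card {k\<in>{1..m}. x \<in> P k} \<le> c) \<and>
        (\<forall>k\<in>{1..m}. J_orlicz M f (P k) = orlicz_norm torus M f / real n))"
proof -
  define C where "C = card (sign_cells :: ('d \<Rightarrow> bool \<times> int) set)"
  show ?thesis
  \<comment> \<open>\<open>4 * C\<close> comes from the count below; the added 1 makes the constant
    suffice for a cover by one cube whatever \<open>C\<close> is.\<close>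
  proof (rule exI[of _ "4 * C + 1"], intro allI impI, elim conjE)
    fix M :: "real \<Rightarrow> real" and f :: "real ^ 'd \<Rightarrow> complex" and n :: nat
    assume M: "orlicz_fun M" and sep: "orlicz_separable M" and f: "f \<in> orlicz_space torus M" and n: "1 \<le> n"
    let ?c = "4 * C + 1"
    let ?Q = "\<exists>m P. m \<le> ?c * n \<and> (\<forall>k\<in>{1..m}. is_cube (P k)) \<and>
        (\<forall>x\<in>torus_set. \<exists>k\<in>{1..m}. x \<in> P k) \<and>
        (\<forall>x\<in>torus_set. card {k\<in>{1..m}. x \<in> P k} \<le> ?c) \<and>
        (\<forall>k\<in>{1..m}. J_orlicz M f (P k) = orlicz_norm torus M f / real n)"
    have fm[measurable]: "f \<in> borel_measurable torus" using f by (simp add: orlicz_space_def)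
    note [measurable] = orlicz_fun_measurable[OF M]
    define L where "L = orlicz_norm torus M f"
    have "0 \<le> L" unfolding L_def by (rule orlicz_norm_nonneg[OF f])
    show ?Q
    \<comment> \<open>In both cases \<open>L / n = L\<close>, and the whole torus is a cube with
      this value of \<open>J\<close>.\<close>
    proof (cases "L = 0 \<or> n = 1")
      case True
      have "is_cube (torus_set :: (real ^ 'd) set)"
        using is_cube_torus_cube[of "1 / 2"] by (simp add: torus_cube_half)
      moreover have "J_orlicz M f torus_set = L / real n"
        using True J_orlicz_torus_set[OF M fm] by (auto simp: L_def)
      moreover have "card {k. k = Suc 0 \<and> x \<in> torus_set} \<le> Suc 0" for x :: "real ^ 'd"
        using card_mono[of "{Suc 0}" "{k. k = Suc 0 \<and> x \<in> torus_set}"] by auto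
      ultimately show ?thesis
        using n by (intro exI[of _ 1] exI[of _ "\<lambda>_. torus_set"]) (auto simp: L_def intro: le_trans)
    next
      case False
      with \<open>0 \<le> L\<close> n have L: "0 < L" and n2: "1 < real n" by auto
      define t where "t = L / real n"
      \<comment> \<open>The strict inequality \<open>t < L\<close> puts the modular at
        \<open>t\<close> above 1 on the whole torus.\<close>
      have t: "0 < t" "t < L" using L n2 by (auto simp: t_def field_simps)
      have fin: "(\<integral>\<^sup>+y. ennreal (M (norm (f y) / t)) \<partial>torus) < \<infinity>"
        by (rule nn_integral_orlicz_torus_finite[OF M sep f t(1)])
      have ge: "1 \<le> (\<integral>\<^sup>+y. ennreal (M (norm (f y) / t)) \<partial>torus)"
        using modular_gt_1[OF t[unfolded L_def]] by simp
      define good where "good x h \<longleftrightarrow> 0 < h \<and> h \<le> 1 / 2 \<and>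
          (\<integral>\<^sup>+y\<in>torus_cube x h. ennreal (M (norm (f y) / (t / measure torus (torus_cube x h)))) \<partial>torus)
            = emeasure torus (torus_cube x h)" for x :: "real ^ 'd" and h
      have "\<exists>h. good x h" if "x \<in> torus_set" for x
        by (rule exists_torus_cube_modular[OF M fm that fin ge]) (auto simp only: good_def)
      then obtain \<rho> where "\<forall>x\<in>torus_set. good x (\<rho> x)"
        using bchoice[of torus_set good] by blast
      then have \<rho>: "\<And>x. x \<in> torus_set \<Longrightarrow> 0 < \<rho> x" "\<And>x. x \<in> torus_set \<Longrightarrow> \<rho> x \<le> 1 / 2"
        and mod: "\<And>x. x \<in> torus_set \<Longrightarrow>
          (\<integral>\<^sup>+y\<in>torus_cube x (\<rho> x). ennreal (M (norm (f y) / (t / measure torus (torus_cube x (\<rho> x))))) \<partial>torus)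
            = emeasure torus (torus_cube x (\<rho> x))"
        by (simp_all add: good_def)
      define U where "U x = torus_cube x (\<rho> x)" for x
      have U[measurable]: "U x \<in> sets torus" for x by (simp add: U_def)
      have Upos: "0 < measure torus (U x)" if "x \<in> torus_set" for x
        unfolding U_def by (rule measure_torus_cube_pos[OF that \<rho>(1)[OF that]])
      have bdd: "bdd_above (\<rho> ` torus_set)" by (rule bdd_aboveI2[OF \<rho>(2)])
      \<comment> \<open>The cut-off is one more than the bound to be proved, so reaching it must
        lead to a contradiction.\<close>
      obtain m z where m: "m \<le> 4 * C * n + 1" and z: "\<And>k. k < m \<Longrightarrow> z k \<in> torus_set"
        and greedy: "\<And>k j. k < m \<Longrightarrow> j < k \<Longrightarrow> z k \<notin> U (z j)"
          "\<And>k j. k < m \<Longrightarrow> j < k \<Longrightarrow> \<rho> (z k) \<le> 2 * \<rho> (z j)"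
        and stop: "m = 4 * C * n + 1 \<or> torus_set \<subseteq> (\<Union>k<m. U (z k))"
        using greedy_selection[of torus_set \<rho> "4 * C * n + 1" U, OF \<rho>(1) bdd] by blast
      have overlap: "card {k. k < m \<and> y \<in> U (z k)} \<le> C" for y
        unfolding C_def U_def
        by (rule card_torus_cube_overlap) (use \<rho> z greedy in \<open>auto simp: U_def\<close>)
      have "m \<noteq> 4 * C * n + 1"
      proof
        assume m_eq: "m = 4 * C * n + 1"
        \<comment> \<open>Any admissible scale below twice the norm will do. This 2 and the two
          summands of the lower bound make up the factor 4.\<close>
        obtain r where r: "0 < r" "r < 2 * L" "(\<integral>\<^sup>+y. ennreal (M (norm (f y) / r)) \<partial>torus) \<le> 1"
          using orlicz_norm_lessE[OF f, of "2 * L"] L by (auto simp: L_def)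
        let ?I = "\<lambda>A. \<integral>\<^sup>+y\<in>A. ennreal (M (norm (f y) / r)) \<partial>torus"
        have "(\<Sum>k<m. ennreal t) \<le> (\<Sum>k<m. ennreal r * (emeasure torus (U (z k)) + ?I (U (z k))))"
          using mod z Upos
          by (intro sum_mono modular_cube_lower_bound[OF M fm U _ t(1) r(1)]) (auto simp: U_def)
        \<comment> \<open>Writing the measure of a cube as the integral of 1 lets the same overlap
          estimate handle both sums.\<close>
        also have "\<dots> = ennreal r * ((\<Sum>k<m. \<integral>\<^sup>+y\<in>U (z k). 1 \<partial>torus) + (\<Sum>k<m. ?I (U (z k))))"
          by (simp add: sum.distrib flip: sum_distrib_left)
        also have "\<dots> \<le> ennreal r * (of_nat C * (\<integral>\<^sup>+y. 1 \<partial>(torus :: (real ^ 'd) measure)) +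
            of_nat C * (\<integral>\<^sup>+y. ennreal (M (norm (f y) / r)) \<partial>torus))"
          by (intro mult_left_mono add_mono sum_nn_integral_overlap_le overlap) auto
        also have "\<dots> \<le> ennreal r * (of_nat C * 1 + of_nat C * 1)"
          using r(3) by (intro mult_left_mono add_mono) (auto simp: emeasure_torus_set)
        also have "\<dots> = ennreal (r * (real C + real C))"
          using r(1) by (simp add: ennreal_of_nat_eq_real_of_nat ennreal_mult flip: ennreal_plus)
        finally have "ennreal (real m * t) \<le> ennreal (r * (real C + real C))"
          using t(1) by (simp add: ennreal_of_nat_eq_real_of_nat ennreal_mult)
        then have "real m * t \<le> r * (real C + real C)"
          using r(1) by (simp add: ennreal_le_iff)
        \<comment> \<open>Since \<open>L = n * t\<close>, this bound equals
          \<open>4 * C * n * t\<close>, which is one \<open>t\<close> short of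
          \<open>m * t\<close>.\<close>
        also have "\<dots> \<le> 2 * L * (real C + real C)" using r(2) by (intro mult_right_mono) auto
        also have "\<dots> = 4 * real C * real n * t" using n2 by (simp add: t_def)
        also have "\<dots> < real m * t" using t(1) by (simp add: m_eq algebra_simps)
        finally show False by simp
      qed
      with m have m': "m \<le> 4 * C * n" by simp
      have cover: "torus_set \<subseteq> (\<Union>k<m. U (z k))" using stop \<open>m \<noteq> 4 * C * n + 1\<close> by blast
      \<comment> \<open>The selection is indexed from 0, the required family from 1.\<close>
      define P where "P k = U (z (k - 1))" for k
      show ?thesis
      proof (intro exI[of _ m] exI[of _ P] conjI ballI)
        show "m \<le> ?c * n" using m' by (simp add: algebra_simps)
      next
        fix k assume k: "k \<in> {1..m}"
        then have zk: "z (k - 1) \<in> torus_set" by (intro z) auto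
        show "is_cube (P k)"
          unfolding P_def U_def by (rule is_cube_torus_cube[OF \<rho>(1)[OF zk] \<rho>(2)[OF zk]])
        show "J_orlicz M f (P k) = orlicz_norm torus M f / real n"
          using J_orlicz_eqI[OF M fm U Upos[OF zk] t(1)] mod[OF zk]
          by (simp add: P_def U_def t_def L_def)
      next
        fix x :: "real ^ 'd" assume "x \<in> torus_set"
        then obtain k where "k < m" "x \<in> U (z k)" using cover by auto
        then show "\<exists>k\<in>{1..m}. x \<in> P k" by (intro bexI[of _ "Suc k"]) (auto simp: P_def)
      next
        fix x :: "real ^ 'd"
        have "{k \<in> {1..m}. x \<in> P k} \<subseteq> Suc ` {k. k < m \<and> x \<in> U (z k)}"
        proof
          fix k assume "k \<in> {k \<in> {1..m}. x \<in> P k}"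
          then show "k \<in> Suc ` {k. k < m \<and> x \<in> U (z k)}"
            by (intro image_eqI[of _ _ "k - 1"]) (auto simp: P_def)
        qed
        then have "card {k \<in> {1..m}. x \<in> P k} \<le> card (Suc ` {k. k < m \<and> x \<in> U (z k)})"
          by (intro card_mono) auto
        also have "\<dots> \<le> C" using overlap[of x] by (simp add: card_image)
        finally show "card {k \<in> {1..m}. x \<in> P k} \<le> ?c" by simp
      qed
    qed
  qed
qed

end
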